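(* If $f\in\operatorname{Dom}\mathcal E$, then $$\frac1{C_1}\int\sqrt{\Gamma(f)}\,d\mu\le\operatorname{Var}f\le\int\sqrt{\Gamma(f)}\,d\mu .$$
   Context: Setting. $(X,d)$ is a compact metric space, $\mu$ is a Borel probability measure on $X$ with $\mu(U)>0$ for every nonempty open $U$. $(\mathcal E,\operatorname{Dom}\mathcal E)$ is a symmetric, strictly local (i.e. strongly local: $\mathcal E(f,g)=0$ whenever $g$ is constant on a neighbourhood of $\operatorname{supp} f$), regular Dirichlet form on $L^2(X,\mu)$ admitting a carré du champ $\Gamma$: a symmetric bilinear positive map $\operatorname{Dom}\mathcal E\times\operatorname{Dom}\mathcal E\to L^1(X,\mu)$ with $\mathcal E(f,g)=\int\Gamma(f,g)\,d\mu$ and $2\int h\,\Gamma(f,g)\,d\mu=\mathcal E(fh,g)+\mathcal E(gh,f)-\mathcal E(fg,h)$ for bounded $f,g,h\in\operatorname{Dom}\mathcal E$; $\Gamma(f):=\Gamma(f,f)$. $\Delta$ is the nonpositive self-adjoint generator, $\mathcal E(u,v)=-\int v\,\Delta u\,d\mu$, and $P_t=e^{t\Delta}$. One-forms. With $\mathcal B_b(X)$ the bounded Borel functions and $\mathcal C=C_b(X)\cap\operatorname{Dom}\mathcal E$, $\mathcal H$ is the Hilbert space obtained from $\mathcal C\otimes\mathcal B_b(X)$ with the form $\langle f_1\otimes g_1,f_2\otimes g_2\rangle_{\mathcal H}=\int g_1g_2\Gamma(f_1,f_2)\,d\mu$ by quotienting out zero-seminorm elements and completing. $\partial f=f\otimes\mathbf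 1$, extended to a closed densely defined operator $\partial:L^2(X,\mu)\to\mathcal H$ with domain $\operatorname{Dom}\mathcal E$; $\partial^*$ is its adjoint; $\vec\Delta=-\partial\partial^*$ is self-adjoint on $\mathcal H$ and $\vec P_t=e^{t\vec\Delta}$. $\mathcal H$ is isometric to a direct integral $\int^\oplus_X\mathcal H_x\,d\mu(x)$ with fibre inner products determined by $\langle f_1\otimes g_1,f_2\otimes g_2\rangle_{\mathcal H_x}=g_1(x)g_2(x)\Gamma(f_1,f_2)(x)$; $\|\eta\|_{\mathcal H_\cdot}$ is the function $x\mapsto\|\eta\|_{\mathcal H_x}$, and $\|\partial f\|_{\mathcal H_x}=\sqrt{\Gamma(f)(x)}$. Standing assumptions. (i) There is $C_1\ge1$ such that $\|\vec P_t\eta\|_{\mathcal H_x}\le C_1(P_t\|\eta\|_{\mathcal H_\cdot})(x)$ for $\mu$-a.e. $x$, all $\eta\in\mathcal H$, $0\le t\le1$; the $C_1$ in the claim is this constant. (ii) $P_t$ has a heat kernel $p_t(x,y)$ (i.e. $P_tf(x)=\int p_t(x,y)f(y)\,d\mu(y)$), jointly continuous in $(t,x,y)$, with $\inf_{x,y}p_t(x,y)>0$ for some $t>0$. Variation. $\operatorname{Var}f=\sup\{\langle f,\partial^*\eta\rangle_2:\eta\in\operatorname{Dom}\partial^*,\ \|\eta\|_{\mathcal H_x}\le1\ \mu\text{-a.e.}\}$. *)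

theory Defs
  imports "HOL-Probability.Probability"
begin

section \<open>The space and its \<open>L\<^sup>2\<close>\<close>

locale compact_metric_prob = prob_space M
  for M :: "'a::metric_space measure" +
  assumes compact_space: "compact (UNIV :: 'a set)"
    and sets_borel: "sets M = sets borel"
    and full_support: "\<And>U. open U \<Longrightarrow> U \<noteq> {} \<Longrightarrow> measure M U > 0"

text \<open>Elements of \<open>L\<^sup>2(M)\<close> are represented by functions; equality in \<open>L\<^sup>2(M)\<close> is equality
  almost everywhere, and all notions below are invariant under it.\<close>

definition L2 :: "'a measure \<Rightarrow> ('a \<Rightarrow> real) set" where
  "L2 M = {f \<in> borel_measurable M. integrable M (\<lambda>x. (f x)\<^sup>2)}"

definition L2_inner :: "'a measure \<Rightarrow> ('a \<Rightarrow> real) \<Rightarrow> ('a \<Rightarrow> real) \<Rightarrow> real" where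
  "L2_inner M f g = (\<integral>x. f x * g x \<partial>M)"

definition L2_norm :: "'a measure \<Rightarrow> ('a \<Rightarrow> real) \<Rightarrow> real" where
  "L2_norm M f = sqrt (L2_inner M f f)"

definition ess_bounded :: "'a measure \<Rightarrow> ('a \<Rightarrow> real) \<Rightarrow> bool" where
  "ess_bounded M f \<longleftrightarrow> (\<exists>B. AE x in M. \<bar>f x\<bar> \<le> B)"

text \<open>The support of the measure \<open>\<bar>f\<bar> M\<close>.\<close>

definition ess_supp :: "'a::topological_space measure \<Rightarrow> ('a \<Rightarrow> real) \<Rightarrow> 'a set" where
  "ess_supp M f = - \<Union>{U. open U \<and> (AE x in M. x \<in> U \<longrightarrow> f x = 0)}"

section \<open>Dirichlet forms\<close>

definition form_norm :: "'a measure \<Rightarrow> (('a \<Rightarrow> real) \<Rightarrow> ('a \<Rightarrow> real) \<Rightarrow> real) \<Rightarrow> ('a \<Rightarrow> real) \<Rightarrow> real"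
  where "form_norm M E f = sqrt (E f f + L2_inner M f f)"

locale dirichlet_form =
  fixes M :: "'a measure" and D :: "('a \<Rightarrow> real) set"
    and E :: "('a \<Rightarrow> real) \<Rightarrow> ('a \<Rightarrow> real) \<Rightarrow> real"
  assumes dom_L2: "D \<subseteq> L2 M"
    and dom_AE: "\<And>f g. f \<in> D \<Longrightarrow> g \<in> borel_measurable M \<Longrightarrow> (AE x in M. f x = g x) \<Longrightarrow> g \<in> D"
    and form_AE: "\<And>f f' g. f \<in> D \<Longrightarrow> f' \<in> D \<Longrightarrow> g \<in> D \<Longrightarrow> (AE x in M. f x = f' x) \<Longrightarrow> E f g = E f' g"
    and dom_linear: "\<And>a b f g. f \<in> D \<Longrightarrow> g \<in> D \<Longrightarrow> (\<lambda>x. a * f x + b * g x) \<in> D"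
    and form_linear: "\<And>a b f g h. f \<in> D \<Longrightarrow> g \<in> D \<Longrightarrow> h \<in> D \<Longrightarrow>
          E (\<lambda>x. a * f x + b * g x) h = a * E f h + b * E g h"
    and form_sym: "\<And>f g. f \<in> D \<Longrightarrow> g \<in> D \<Longrightarrow> E f g = E g f"
    and form_nonneg: "\<And>f. f \<in> D \<Longrightarrow> 0 \<le> E f f"
    and dom_dense: "\<And>f e. f \<in> L2 M \<Longrightarrow> 0 < e \<Longrightarrow> \<exists>g\<in>D. L2_norm M (\<lambda>x. f x - g x) < e"
    and form_closed: "\<And>u :: nat \<Rightarrow> 'a \<Rightarrow> real. (\<forall>n. u n \<in> D) \<Longrightarrow>
          (\<forall>e>0. \<exists>N. \<forall>m\<ge>N. \<forall>n\<ge>N. form_norm M E (\<lambda>x. u m x - u n x) < e) \<Longrightarrow>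
          \<exists>f\<in>D. (\<lambda>n. form_norm M E (\<lambda>x. u n x - f x)) \<longlonglongrightarrow> 0"
    and markov: "\<And>f. f \<in> D \<Longrightarrow> (\<lambda>x. min (max (f x) 0) 1) \<in> D
          \<and> E (\<lambda>x. min (max (f x) 0) 1) (\<lambda>x. min (max (f x) 0) 1) \<le> E f f"

text \<open>The space \<open>C\<^sub>b(X) \<inter> Dom E\<close>.\<close>

definition cont_dom :: "('a::topological_space \<Rightarrow> real) set \<Rightarrow> ('a \<Rightarrow> real) set" where
  "cont_dom D = {f \<in> D. continuous_on UNIV f \<and> bounded (range f)}"

text \<open>On a compact space, \<open>C\<^sub>c(X)\<close> is the space of all continuous functions.\<close>

definition regular_form :: "'a::topological_space measure \<Rightarrow> ('a \<Rightarrow> real) set \<Rightarrow>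
    (('a \<Rightarrow> real) \<Rightarrow> ('a \<Rightarrow> real) \<Rightarrow> real) \<Rightarrow> bool" where
  "regular_form M D E \<longleftrightarrow>
     (\<forall>f\<in>D. \<forall>e>0. \<exists>g\<in>cont_dom D. form_norm M E (\<lambda>x. f x - g x) < e) \<and>
     (\<forall>f. continuous_on UNIV f \<longrightarrow> (\<forall>e>0. \<exists>g\<in>cont_dom D. \<forall>x. \<bar>f x - g x\<bar> < e))"

definition strictly_local :: "'a::topological_space measure \<Rightarrow> ('a \<Rightarrow> real) set \<Rightarrow>
    (('a \<Rightarrow> real) \<Rightarrow> ('a \<Rightarrow> real) \<Rightarrow> real) \<Rightarrow> bool" where
  "strictly_local M D E \<longleftrightarrow>
     (\<forall>f\<in>D. \<forall>g\<in>D. \<forall>U c. open U \<and> ess_supp M f \<subseteq> U \<and> (AE x in M. x \<in> U \<longrightarrow> g x = c) \<longrightarrow> E f g = 0)"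

locale carre_du_champ =
  fixes M :: "'a measure" and D :: "('a \<Rightarrow> real) set"
    and E :: "('a \<Rightarrow> real) \<Rightarrow> ('a \<Rightarrow> real) \<Rightarrow> real"
    and \<Gamma> :: "('a \<Rightarrow> real) \<Rightarrow> ('a \<Rightarrow> real) \<Rightarrow> 'a \<Rightarrow> real"
  assumes Gamma_L1: "\<And>f g. f \<in> D \<Longrightarrow> g \<in> D \<Longrightarrow> integrable M (\<Gamma> f g)"
    and Gamma_AE: "\<And>f f' g. f \<in> D \<Longrightarrow> f' \<in> D \<Longrightarrow> g \<in> D \<Longrightarrow> (AE x in M. f x = f' x) \<Longrightarrow>
          AE x in M. \<Gamma> f g x = \<Gamma> f' g x"
    and Gamma_linear: "\<And>a b f g h. f \<in> D \<Longrightarrow> g \<in> D \<Longrightarrow> h \<in> D \<Longrightarrow>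
          AE x in M. \<Gamma> (\<lambda>y. a * f y + b * g y) h x = a * \<Gamma> f h x + b * \<Gamma> g h x"
    and Gamma_sym: "\<And>f g. f \<in> D \<Longrightarrow> g \<in> D \<Longrightarrow> AE x in M. \<Gamma> f g x = \<Gamma> g f x"
    and Gamma_nonneg: "\<And>f. f \<in> D \<Longrightarrow> AE x in M. 0 \<le> \<Gamma> f f x"
    and Gamma_integral: "\<And>f g. f \<in> D \<Longrightarrow> g \<in> D \<Longrightarrow> E f g = (\<integral>x. \<Gamma> f g x \<partial>M)"
    and Gamma_form: "\<And>f g h. f \<in> D \<Longrightarrow> g \<in> D \<Longrightarrow> h \<in> D \<Longrightarrow>
          ess_bounded M f \<Longrightarrow> ess_bounded M g \<Longrightarrow> ess_bounded M h \<Longrightarrow>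
          2 * (\<integral>x. h x * \<Gamma> f g x \<partial>M)
            = E (\<lambda>x. f x * h x) g + E (\<lambda>x. g x * h x) f - E (\<lambda>x. f x * g x) h"

section \<open>Semigroups\<close>

text \<open>Unbounded operators are given by their graphs. For a nonpositive self-adjoint operator \<open>A\<close>,
  \<open>e\<^sup>t\<^sup>A\<close> is the strongly continuous semigroup whose infinitesimal generator (with its exact domain)
  is \<open>A\<close>; it is unique.\<close>

locale L2_semigroup_generated =
  fixes M :: "'a measure" and A :: "(('a \<Rightarrow> real) \<times> ('a \<Rightarrow> real)) set"
    and P :: "real \<Rightarrow> ('a \<Rightarrow> real) \<Rightarrow> ('a \<Rightarrow> real)"
  assumes P_L2: "\<And>t f. 0 \<le> t \<Longrightarrow> f \<in> L2 M \<Longrightarrow> P t f \<in> L2 M"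
    and P_linear: "\<And>t a b f g. 0 \<le> t \<Longrightarrow> f \<in> L2 M \<Longrightarrow> g \<in> L2 M \<Longrightarrow>
          AE x in M. P t (\<lambda>y. a * f y + b * g y) x = a * P t f x + b * P t g x"
    and P_bounded: "\<And>t. 0 \<le> t \<Longrightarrow> \<exists>K. \<forall>f\<in>L2 M. L2_norm M (P t f) \<le> K * L2_norm M f"
    and P_0: "\<And>f. f \<in> L2 M \<Longrightarrow> AE x in M. P 0 f x = f x"
    and P_add: "\<And>s t f. 0 \<le> s \<Longrightarrow> 0 \<le> t \<Longrightarrow> f \<in> L2 M \<Longrightarrow> AE x in M. P (s + t) f x = P s (P t f) x"
    and P_cont: "\<And>f. f \<in> L2 M \<Longrightarrow> ((\<lambda>t. L2_norm M (\<lambda>x. P t f x - f x)) \<longlongrightarrow> 0) (at_right 0)"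
    and P_generator: "A = {(u, v). u \<in> L2 M \<and> v \<in> L2 M \<and>
          ((\<lambda>t. L2_norm M (\<lambda>x. (P t u x - u x) / t - v x)) \<longlongrightarrow> 0) (at_right 0)}"

locale semigroup_generated =
  fixes A :: "('h::real_normed_vector \<times> 'h) set" and T :: "real \<Rightarrow> 'h \<Rightarrow> 'h"
  assumes T_bounded_linear: "\<And>t. 0 \<le> t \<Longrightarrow> bounded_linear (T t)"
    and T_0: "\<And>u. T 0 u = u"
    and T_add: "\<And>s t u. 0 \<le> s \<Longrightarrow> 0 \<le> t \<Longrightarrow> T (s + t) u = T s (T t u)"
    and T_cont: "\<And>u. ((\<lambda>t. T t u) \<longlongrightarrow> u) (at_right 0)"
    and T_generator: "A = {(u, v). ((\<lambda>t. (T t u - u) /\<^sub>R t) \<longlongrightarrow> v) (at_right 0)}"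

text \<open>The operator \<open>\<Delta>\<close> determined by \<open>E(u, v) = - \<integral> v \<Delta>u\<close> for all \<open>v \<in> Dom E\<close>.\<close>

definition laplacian :: "'a measure \<Rightarrow> ('a \<Rightarrow> real) set \<Rightarrow> (('a \<Rightarrow> real) \<Rightarrow> ('a \<Rightarrow> real) \<Rightarrow> real) \<Rightarrow>
    (('a \<Rightarrow> real) \<times> ('a \<Rightarrow> real)) set" where
  "laplacian M D E = {(u, w). u \<in> D \<and> w \<in> L2 M \<and> (\<forall>v\<in>D. E u v = - L2_inner M v w)}"

locale heat_kernel =
  fixes M :: "'a::topological_space measure" and P :: "real \<Rightarrow> ('a \<Rightarrow> real) \<Rightarrow> ('a \<Rightarrow> real)"
    and p :: "real \<Rightarrow> 'a \<Rightarrow> 'a \<Rightarrow> real"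
  assumes kernel: "\<And>t f. 0 < t \<Longrightarrow> f \<in> L2 M \<Longrightarrow> AE x in M. P t f x = (\<integral>y. p t x y * f y \<partial>M)"
    and kernel_cont: "continuous_on ({0<..} \<times> UNIV \<times> UNIV) (\<lambda>(t, x, y). p t x y)"
    and kernel_pos: "\<exists>t>0. 0 < (INF (x, y)\<in>UNIV. p t x y)"

section \<open>One-forms\<close>

definition bounded_borel :: "('a::topological_space \<Rightarrow> real) set" where
  "bounded_borel = {g \<in> borel_measurable borel. bounded (range g)}"

text \<open>The Hausdorff completion of \<open>C \<otimes> B\<^sub>b\<close> is a Hilbert space together with a seminorm-preserving
  linear map from \<open>C \<otimes> B\<^sub>b\<close> onto a dense subspace; it is unique up to unique isometry. The linear
  map is given by the corresponding bilinear map \<open>tens\<close> on \<open>C \<times> B\<^sub>b\<close>.\<close>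

locale one_forms =
  fixes M :: "'a::topological_space measure" and D :: "('a \<Rightarrow> real) set"
    and \<Gamma> :: "('a \<Rightarrow> real) \<Rightarrow> ('a \<Rightarrow> real) \<Rightarrow> 'a \<Rightarrow> real"
    and tens :: "('a \<Rightarrow> real) \<Rightarrow> ('a \<Rightarrow> real) \<Rightarrow> 'h::{real_inner, complete_space}"
  assumes tens_linear_left: "\<And>a b f1 f2 g. f1 \<in> cont_dom D \<Longrightarrow> f2 \<in> cont_dom D \<Longrightarrow> g \<in> bounded_borel \<Longrightarrow>
          tens (\<lambda>x. a * f1 x + b * f2 x) g = a *\<^sub>R tens f1 g + b *\<^sub>R tens f2 g"
    and tens_linear_right: "\<And>a b f g1 g2. f \<in> cont_dom D \<Longrightarrow> g1 \<in> bounded_borel \<Longrightarrow> g2 \<in> bounded_borel \<Longrightarrow>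
          tens f (\<lambda>x. a * g1 x + b * g2 x) = a *\<^sub>R tens f g1 + b *\<^sub>R tens f g2"
    and tens_inner: "\<And>f1 f2 g1 g2. f1 \<in> cont_dom D \<Longrightarrow> f2 \<in> cont_dom D \<Longrightarrow>
          g1 \<in> bounded_borel \<Longrightarrow> g2 \<in> bounded_borel \<Longrightarrow>
          inner (tens f1 g1) (tens f2 g2) = (\<integral>x. g1 x * g2 x * \<Gamma> f1 f2 x \<partial>M)"
    and tens_dense: "closure (span {tens f g | f g. f \<in> cont_dom D \<and> g \<in> bounded_borel}) = UNIV"

text \<open>Graph of \<open>\<partial>\<close>: the closure of \<open>f \<mapsto> f \<otimes> 1\<close>, \<open>f \<in> C\<close>, as an operator from \<open>L\<^sup>2(M)\<close> to \<open>H\<close>.\<close>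

definition grad :: "'a::topological_space measure \<Rightarrow> ('a \<Rightarrow> real) set \<Rightarrow>
    (('a \<Rightarrow> real) \<Rightarrow> ('a \<Rightarrow> real) \<Rightarrow> 'h::real_inner) \<Rightarrow> (('a \<Rightarrow> real) \<times> 'h) set" where
  "grad M D tens = {(f, \<eta>). f \<in> L2 M \<and> (\<exists>u :: nat \<Rightarrow> 'a \<Rightarrow> real. (\<forall>n. u n \<in> cont_dom D) \<and>
     (\<lambda>n. L2_norm M (\<lambda>x. u n x - f x)) \<longlonglongrightarrow> 0 \<and> (\<lambda>n. tens (u n) (\<lambda>_. 1)) \<longlonglongrightarrow> \<eta>)}"

definition grad_adj :: "'a::topological_space measure \<Rightarrow> ('a \<Rightarrow> real) set \<Rightarrow>
    (('a \<Rightarrow> real) \<Rightarrow> ('a \<Rightarrow> real) \<Rightarrow> 'h::real_inner) \<Rightarrow> ('h \<times> ('a \<Rightarrow> real)) set" where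
  "grad_adj M D tens =
     {(\<eta>, w). w \<in> L2 M \<and> (\<forall>(f, \<zeta>)\<in>grad M D tens. inner \<zeta> \<eta> = L2_inner M f w)}"

definition form_laplacian :: "'a::topological_space measure \<Rightarrow> ('a \<Rightarrow> real) set \<Rightarrow>
    (('a \<Rightarrow> real) \<Rightarrow> ('a \<Rightarrow> real) \<Rightarrow> 'h::real_inner) \<Rightarrow> ('h \<times> 'h) set" where
  "form_laplacian M D tens =
     {(\<eta>, - \<zeta>) | \<eta> \<zeta>. \<exists>w. (\<eta>, w) \<in> grad_adj M D tens \<and> (w, \<zeta>) \<in> grad M D tens}"

section \<open>Direct integrals\<close>

text \<open>A measurable field of Hilbert spaces in the sense of Dixmier: fibres \<open>F x\<close> and the space \<open>S\<close>
  of measurable sections. The fibres of such a field are separable, so there is no loss in taking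
  them to be closed subspaces of one Hilbert space.\<close>

locale measurable_hilbert_field =
  fixes M :: "'a measure" and F :: "'a \<Rightarrow> 'k::{real_inner, complete_space} set"
    and S :: "('a \<Rightarrow> 'k) set"
  assumes fibre_subspace: "\<And>x. subspace (F x)"
    and fibre_closed: "\<And>x. closed (F x)"
    and section_fibre: "\<And>\<xi> x. \<xi> \<in> S \<Longrightarrow> \<xi> x \<in> F x"
    and section_linear: "\<And>a b \<xi> \<zeta>. \<xi> \<in> S \<Longrightarrow> \<zeta> \<in> S \<Longrightarrow> (\<lambda>x. a *\<^sub>R \<xi> x + b *\<^sub>R \<zeta> x) \<in> S"
    and section_norm: "\<And>\<xi>. \<xi> \<in> S \<Longrightarrow> (\<lambda>x. norm (\<xi> x)) \<in> borel_measurable M"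
    and section_saturated: "\<And>\<zeta>. (\<forall>x. \<zeta> x \<in> F x) \<Longrightarrow>
          (\<forall>\<xi>\<in>S. (\<lambda>x. inner (\<xi> x) (\<zeta> x)) \<in> borel_measurable M) \<Longrightarrow> \<zeta> \<in> S"
    and section_total: "\<exists>\<xi> :: nat \<Rightarrow> 'a \<Rightarrow> 'k. (\<forall>n. \<xi> n \<in> S) \<and>
          (\<forall>x. closure (span (range (\<lambda>n. \<xi> n x))) = F x)"

definition L2_sections :: "'a measure \<Rightarrow> ('a \<Rightarrow> 'k::real_inner) set \<Rightarrow> ('a \<Rightarrow> 'k) set" where
  "L2_sections M S = {\<xi> \<in> S. integrable M (\<lambda>x. (norm (\<xi> x))\<^sup>2)}"

text \<open>\<open>\<Phi>\<close> is an isometric isomorphism of \<open>H\<close> onto the direct integral of the field \<open>(F, S)\<close>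
  (square-integrable measurable sections modulo equality almost everywhere), compatible with the
  fibre inner products. Thus the norm of \<open>\<eta>\<close> in the fibre over \<open>x\<close> is \<open>norm (\<Phi> \<eta> x)\<close>.\<close>

locale direct_integral_decomposition = measurable_hilbert_field M F S
  for M :: "'a::topological_space measure" and F :: "'a \<Rightarrow> 'k::{real_inner, complete_space} set"
    and S :: "('a \<Rightarrow> 'k) set" +
  fixes D :: "('a \<Rightarrow> real) set"
    and \<Gamma> :: "('a \<Rightarrow> real) \<Rightarrow> ('a \<Rightarrow> real) \<Rightarrow> 'a \<Rightarrow> real"
    and tens :: "('a \<Rightarrow> real) \<Rightarrow> ('a \<Rightarrow> real) \<Rightarrow> 'h::{real_inner, complete_space}"
    and \<Phi> :: "'h \<Rightarrow> 'a \<Rightarrow> 'k"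
  assumes Phi_L2: "\<And>\<eta>. \<Phi> \<eta> \<in> L2_sections M S"
    and Phi_linear: "\<And>a b \<eta> \<zeta>. AE x in M. \<Phi> (a *\<^sub>R \<eta> + b *\<^sub>R \<zeta>) x = a *\<^sub>R \<Phi> \<eta> x + b *\<^sub>R \<Phi> \<zeta> x"
    and Phi_isometric: "\<And>\<eta> \<zeta>. inner \<eta> \<zeta> = (\<integral>x. inner (\<Phi> \<eta> x) (\<Phi> \<zeta> x) \<partial>M)"
    and Phi_onto: "\<And>\<xi>. \<xi> \<in> L2_sections M S \<Longrightarrow> \<exists>\<eta>. AE x in M. \<Phi> \<eta> x = \<xi> x"
    and Phi_fibre: "\<And>f1 f2 g1 g2. f1 \<in> cont_dom D \<Longrightarrow> f2 \<in> cont_dom D \<Longrightarrow>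
          g1 \<in> bounded_borel \<Longrightarrow> g2 \<in> bounded_borel \<Longrightarrow>
          AE x in M. inner (\<Phi> (tens f1 g1) x) (\<Phi> (tens f2 g2) x) = g1 x * g2 x * \<Gamma> f1 f2 x"

section \<open>Variation\<close>

definition Var :: "'a::topological_space measure \<Rightarrow> ('a \<Rightarrow> real) set \<Rightarrow>
    (('a \<Rightarrow> real) \<Rightarrow> ('a \<Rightarrow> real) \<Rightarrow> 'h::real_inner) \<Rightarrow> ('h \<Rightarrow> 'a \<Rightarrow> 'k::real_inner) \<Rightarrow>
    ('a \<Rightarrow> real) \<Rightarrow> ereal" where
  "Var M D tens \<Phi> f = Sup {ereal (L2_inner M f w) | \<eta> w.
     (\<eta>, w) \<in> grad_adj M D tens \<and> (AE x in M. norm (\<Phi> \<eta> x) \<le> 1)}"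

end

theory Submission
  imports Defs
begin

text \<open>Let \<open>\<zeta>\<close> be the gradient of \<open>f\<close>; its fibre norm is
  \<open>sqrt (\<Gamma> f f)\<close> (\<open>gradient_exists\<close>). The upper bound is the
  fibrewise Cauchy-Schwarz inequality: for an admissible test form \<open>\<eta>\<close> the
  pairing of \<open>f\<close> with \<open>\<partial>\<^sup>* \<eta>\<close> equals
  \<open>\<langle>\<zeta>, \<eta>\<rangle>\<close>, which is at most the integral of the fibre
  norm of \<open>\<zeta>\<close>.

  For the lower bound the optimal test form would be the direction \<open>\<eta>\<^sub>0\<close>
  of \<open>\<zeta>\<close>, which has fibre norm at most one but need not lie in the domain of
  \<open>\<partial>\<^sup>*\<close>. It is regularized by the semigroup on one-forms: the time
  average over \<open>{0..s}\<close> of its orbit lies in the domain of the generator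
  (\<open>weak_orbit_integral\<close>), hence in that of \<open>\<partial>\<^sup>*\<close>, and it
  tends to \<open>\<eta>\<^sub>0\<close> as \<open>s\<close> tends to zero. By the domination of
  the semigroup on one-forms, and because the heat semigroup does not exceed one on functions with
  values in \<open>{0..1}\<close> (\<open>P_Markov\<close>), the orbit has fibre norm at most
  \<open>C1\<close>, and so does its average (\<open>weak_integral_fibre_bound\<close>). Dividing
  by \<open>C1\<close> yields admissible test forms.

  The heat semigroup is given through its generator, so contractivity and the Markov property have
  to be derived from the form. Both are instances of \<open>P_decreases_residual\<close>: along an
  orbit that starts in the domain of the generator, the squared distance to a closed convex set
  that is compatible with the form has nonpositive right derivative, and the domain is dense by a
  resolvent argument (\<open>laplacian_dom_dense\<close>). The Riesz representation is proved for
  semi-inner products on a carrier, since it is needed both for the form domain, whose elements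
  are functions, and for the space of one-forms.\<close>

section \<open>Semi-inner products and the Riesz representation\<close>

text \<open>A positive semidefinite symmetric bilinear form on a carrier. The operation
  \<open>lin a x b y\<close> stands for the linear combination \<open>a x + b y\<close>; keeping it a parameter lets the
  carrier be a space of functions, where vectors are only identified almost everywhere.\<close>

locale semi_inner =
  fixes V :: "'v set" and lin :: "real \<Rightarrow> 'v \<Rightarrow> real \<Rightarrow> 'v \<Rightarrow> 'v" and B :: "'v \<Rightarrow> 'v \<Rightarrow> real"
  assumes lin_in: "\<And>a b x y. x \<in> V \<Longrightarrow> y \<in> V \<Longrightarrow> lin a x b y \<in> V"
    and B_lin: "\<And>a b x y z. x \<in> V \<Longrightarrow> y \<in> V \<Longrightarrow> z \<in> V \<Longrightarrow> B (lin a x b y) z = a * B x z + b * B y z"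
    and B_sym: "\<And>x y. x \<in> V \<Longrightarrow> y \<in> V \<Longrightarrow> B x y = B y x"
    and B_nonneg: "\<And>x. x \<in> V \<Longrightarrow> 0 \<le> B x x"

lemma quadratic_nonneg_imp_le:
  fixes b c e :: real
  assumes "\<And>s. 0 \<le> e + 2 * s * c + s\<^sup>2 * b" and "0 \<le> b"
  shows "c\<^sup>2 \<le> b * e"
proof (cases "b = 0")
  case True
  have "c = 0"
  proof (rule ccontr)
    assume "c \<noteq> 0"
    then show False
      using assms(1)[of "- (e + 1) / (2 * c)"] True by (simp add: field_simps)
  qed
  then show ?thesis using True by simp
next
  case False
  then have "b > 0" using assms(2) by simp
  then have "0 \<le> e - c\<^sup>2 / b"
    using assms(1)[of "- c / b"] by (simp add: field_simps power2_eq_square)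
  then show ?thesis using \<open>b > 0\<close> by (simp add: field_simps)
qed

context semi_inner
begin

lemma B_quadratic:
  assumes "x \<in> V" "y \<in> V"
  shows "B (lin a x b y) (lin a x b y) = a\<^sup>2 * B x x + 2 * a * b * B x y + b\<^sup>2 * B y y"
proof -
  have xy: "lin a x b y \<in> V" using assms lin_in by blast
  have 1: "B x (lin a x b y) = a * B x x + b * B x y"
    using B_sym[OF assms(1) xy] B_lin[OF assms assms(1)] B_sym[OF assms] by simp
  have 2: "B y (lin a x b y) = a * B x y + b * B y y"
    using B_sym[OF assms(2) xy] B_lin[OF assms assms(2)] by simp
  show ?thesis
    using B_lin[OF assms xy, of a b] 1 2 by (simp add: algebra_simps power2_eq_square)
qed

lemma Cauchy_Schwarz_square:
  assumes "x \<in> V" "y \<in> V"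
  shows "(B x y)\<^sup>2 \<le> B x x * B y y"
proof -
  have "0 \<le> B x x + 2 * s * B x y + s\<^sup>2 * B y y" for s
    using B_nonneg[OF lin_in[OF assms, of 1 s]] B_quadratic[OF assms, of 1 s] by simp
  from quadratic_nonneg_imp_le[OF this B_nonneg[OF assms(2)]] show ?thesis
    by (simp add: mult.commute)
qed

lemma Cauchy_Schwarz:
  assumes "x \<in> V" "y \<in> V"
  shows "\<bar>B x y\<bar> \<le> sqrt (B x x) * sqrt (B y y)"
  using real_sqrt_le_mono[OF Cauchy_Schwarz_square[OF assms]] by (simp add: real_sqrt_mult)

lemma triangle:
  assumes "x \<in> V" "y \<in> V"
  shows "sqrt (B (lin a x b y) (lin a x b y)) \<le> \<bar>a\<bar> * sqrt (B x x) + \<bar>b\<bar> * sqrt (B y y)"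
proof (rule real_le_lsqrt)
  let ?X = "sqrt (B x x)" and ?Y = "sqrt (B y y)"
  have X: "?X\<^sup>2 = B x x" "?Y\<^sup>2 = B y y" using assms B_nonneg by auto
  have "a * b * B x y \<le> \<bar>a * b\<bar> * \<bar>B x y\<bar>" by (metis abs_ge_self abs_mult)
  also have "\<dots> \<le> \<bar>a * b\<bar> * (?X * ?Y)"
    by (intro mult_left_mono Cauchy_Schwarz assms) auto
  finally have "a * b * B x y \<le> \<bar>a\<bar> * \<bar>b\<bar> * (?X * ?Y)" by (simp add: abs_mult)
  then show "B (lin a x b y) (lin a x b y) \<le> (\<bar>a\<bar> * ?X + \<bar>b\<bar> * ?Y)\<^sup>2"
    unfolding B_quadratic[OF assms] by (simp add: power2_sum power_mult_distrib X algebra_simps)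
qed (use assms B_nonneg in auto)

text \<open>The functional \<open>B x x - 2 l x\<close> is bounded below; a minimizing sequence is Cauchy by the
  parallelogram law, and its limit represents \<open>l\<close>.\<close>

theorem Riesz_representation:
  assumes nonempty: "V \<noteq> {}"
    and l_lin: "\<And>a b x y. x \<in> V \<Longrightarrow> y \<in> V \<Longrightarrow> l (lin a x b y) = a * l x + b * l y"
    and l_bound: "\<And>x. x \<in> V \<Longrightarrow> \<bar>l x\<bar> \<le> K * sqrt (B x x)"
    and complete: "\<And>u :: nat \<Rightarrow> 'v. (\<forall>n. u n \<in> V) \<Longrightarrow>
      (\<forall>e>0. \<exists>N. \<forall>m\<ge>N. \<forall>n\<ge>N. sqrt (B (lin 1 (u m) (-1) (u n)) (lin 1 (u m) (-1) (u n))) < e) \<Longrightarrow>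
      \<exists>x\<in>V. (\<lambda>n. sqrt (B (lin 1 (u n) (-1) x) (lin 1 (u n) (-1) x))) \<longlonglongrightarrow> 0"
  shows "\<exists>x\<in>V. \<forall>y\<in>V. B x y = l y"
proof -
  define J where "J x = B x x - 2 * l x" for x
  have J_below: "- K\<^sup>2 \<le> J x" if "x \<in> V" for x
  proof -
    have "2 * l x \<le> 2 * (K * sqrt (B x x))" using l_bound[OF that] by linarith
    also have "\<dots> \<le> K\<^sup>2 + (sqrt (B x x))\<^sup>2"
      using sum_squares_bound[of K "sqrt (B x x)"] by simp
    finally show ?thesis using B_nonneg[OF that] by (simp add: J_def)
  qed
  define m where "m = Inf (J ` V)"
  have bdd: "bdd_below (J ` V)" using J_below by (auto intro!: bdd_belowI)
  have m_le: "m \<le> J x" if "x \<in> V" for x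
    unfolding m_def using that bdd by (simp add: cInf_lower)
  have "\<exists>x\<in>V. J x < m + 1 / real (Suc n)" for n
  proof -
    have "m < m + 1 / real (Suc n)" by simp
    then show ?thesis
      unfolding m_def using cInf_lessD[of "J ` V"] nonempty by blast
  qed
  then obtain u where u: "\<And>n. u n \<in> V" and Ju: "\<And>n. J (u n) < m + 1 / real (Suc n)"
    by metis
  have close: "B (lin 1 (u i) (-1) (u j)) (lin 1 (u i) (-1) (u j)) \<le> 2 / real (Suc i) + 2 / real (Suc j)"
    for i j
  proof -
    have "4 * m \<le> 4 * J (lin (1/2) (u i) (1/2) (u j))"
      using m_le[OF lin_in[OF u u]] by simp
    also have "\<dots> = 2 * J (u i) + 2 * J (u j) - B (lin 1 (u i) (-1) (u j)) (lin 1 (u i) (-1) (u j))"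
      unfolding J_def B_quadratic[OF u u] l_lin[OF u u] by (simp add: power2_eq_square algebra_simps)
    finally show ?thesis using Ju[of i] Ju[of j] by linarith
  qed
  have "\<exists>N. \<forall>i\<ge>N. \<forall>j\<ge>N. sqrt (B (lin 1 (u i) (-1) (u j)) (lin 1 (u i) (-1) (u j))) < e"
    if "e > 0" for e
  proof -
    obtain N where N: "inverse (real (Suc N)) < e\<^sup>2 / 4"
      using reals_Archimedean[of "e\<^sup>2 / 4"] \<open>e > 0\<close> by auto
    have small: "2 / real (Suc i) < e\<^sup>2 / 2" if "i \<ge> N" for i
    proof -
      have "1 / real (Suc i) \<le> 1 / real (Suc N)" using that by (simp add: frac_le)
      then show ?thesis using N by (simp add: inverse_eq_divide)
    qed
    have "sqrt (B (lin 1 (u i) (-1) (u j)) (lin 1 (u i) (-1) (u j))) < e" if "i \<ge> N" "j \<ge> N" for i j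
    proof -
      have "B (lin 1 (u i) (-1) (u j)) (lin 1 (u i) (-1) (u j)) < e\<^sup>2"
        using close[of i j] small[OF that(1)] small[OF that(2)] by linarith
      then show ?thesis using \<open>e > 0\<close> by (metis real_sqrt_less_iff real_sqrt_abs abs_of_pos)
    qed
    then show ?thesis by blast
  qed
  then obtain x where x: "x \<in> V"
    and lim: "(\<lambda>n. sqrt (B (lin 1 (u n) (-1) x) (lin 1 (u n) (-1) x))) \<longlonglongrightarrow> 0"
    using complete[of u] u by blast
  have "B x y = l y" if y: "y \<in> V" for y
  proof -
    have sq: "(B (u n) y - l y)\<^sup>2 \<le> B y y * (1 / real (Suc n))" for n
    proof (rule quadratic_nonneg_imp_le[OF _ B_nonneg[OF y]])
      fix s
      have "m \<le> J (lin 1 (u n) s y)" using m_le lin_in u y by blast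
      also have "\<dots> = J (u n) + 2 * s * (B (u n) y - l y) + s\<^sup>2 * B y y"
        unfolding J_def B_quadratic[OF u y] l_lin[OF u y] by (simp add: algebra_simps)
      finally show "0 \<le> 1 / real (Suc n) + 2 * s * (B (u n) y - l y) + s\<^sup>2 * B y y"
        using Ju[of n] by linarith
    qed
    have "(\<lambda>n. B y y * (1 / real (Suc n))) \<longlonglongrightarrow> B y y * 0"
      by (intro tendsto_mult tendsto_const) (use LIMSEQ_inverse_real_of_nat in \<open>simp add: inverse_eq_divide\<close>)
    then have lim0: "(\<lambda>n. B y y * (1 / real (Suc n))) \<longlonglongrightarrow> 0" by (simp only: mult_zero_right)
    have "(\<lambda>n. (B (u n) y - l y)\<^sup>2) \<longlonglongrightarrow> 0"
    proof (rule Lim_null_comparison[OF _ lim0])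
      show "\<forall>\<^sub>F n in sequentially. norm ((B (u n) y - l y)\<^sup>2) \<le> B y y * (1 / real (Suc n))"
        unfolding real_norm_def abs_power2 by (intro always_eventually allI sq)
    qed
    then have "(\<lambda>n. B (u n) y - l y) \<longlonglongrightarrow> 0"
      using tendsto_real_sqrt[of "\<lambda>n. (B (u n) y - l y)\<^sup>2" 0] by (simp add: tendsto_rabs_zero_iff)
    then have 1: "(\<lambda>n. B (u n) y) \<longlonglongrightarrow> l y" by (simp add: LIM_zero_iff)
    have "(\<lambda>n. B (u n) y - B x y) \<longlonglongrightarrow> 0"
    proof (rule Lim_null_comparison[OF _ tendsto_mult_left_zero[OF lim]])
      have "\<bar>B (u n) y - B x y\<bar> \<le> sqrt (B (lin 1 (u n) (-1) x) (lin 1 (u n) (-1) x)) * sqrt (B y y)" for n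
        using Cauchy_Schwarz[OF lin_in[OF u x, of 1 _ "-1"] y] B_lin[OF u x y, of 1 _ "-1"] by simp
      then show "\<forall>\<^sub>F n in sequentially. norm (B (u n) y - B x y)
          \<le> sqrt (B (lin 1 (u n) (-1) x) (lin 1 (u n) (-1) x)) * sqrt (B y y)"
        unfolding real_norm_def by (intro always_eventually allI)
    qed
    then have "(\<lambda>n. B (u n) y) \<longlonglongrightarrow> B x y" by (simp add: LIM_zero_iff)
    then show ?thesis using 1 LIMSEQ_unique by blast
  qed
  then show ?thesis using x by blast
qed

end

lemma semi_inner_UNIV:
  "semi_inner (UNIV :: 'h::real_inner set) (\<lambda>a x b y. a *\<^sub>R x + b *\<^sub>R y) inner"
  by unfold_locales (auto simp: inner_add_left intro: inner_commute)

lemma Hilbert_Riesz: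
  fixes l :: "'h::{real_inner, complete_space} \<Rightarrow> real"
  assumes lin: "\<And>a b x y. l (a *\<^sub>R x + b *\<^sub>R y) = a * l x + b * l y"
    and bound: "\<And>x. \<bar>l x\<bar> \<le> K * norm x"
  shows "\<exists>v. \<forall>x. inner v x = l x"
proof -
  interpret semi_inner "UNIV :: 'h set" "\<lambda>a x b y. a *\<^sub>R x + b *\<^sub>R y" inner
    by (rule semi_inner_UNIV)
  have "\<exists>x\<in>UNIV. \<forall>y\<in>UNIV. inner x y = l y"
  proof (rule Riesz_representation)
    fix u :: "nat \<Rightarrow> 'h"
    assume "\<forall>e>0. \<exists>N. \<forall>m\<ge>N. \<forall>n\<ge>N.
      sqrt (inner (1 *\<^sub>R u m + (-1) *\<^sub>R u n) (1 *\<^sub>R u m + (-1) *\<^sub>R u n)) < e"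
    then have "Cauchy u" by (simp add: Cauchy_def dist_norm norm_eq_sqrt_inner)
    then obtain x where "u \<longlonglongrightarrow> x" using Cauchy_convergent convergent_def by blast
    then have "(\<lambda>n. norm (u n - x)) \<longlonglongrightarrow> 0" using LIM_zero tendsto_norm_zero by blast
    then show "\<exists>x\<in>UNIV. (\<lambda>n. sqrt (inner (1 *\<^sub>R u n + (-1) *\<^sub>R x) (1 *\<^sub>R u n + (-1) *\<^sub>R x))) \<longlonglongrightarrow> 0"
      by (auto simp: norm_eq_sqrt_inner)
  qed (use lin bound in \<open>auto simp: norm_eq_sqrt_inner\<close>)
  then show ?thesis by simp
qed

section \<open>Square-integrable functions\<close>

lemma L2_measurable: "f \<in> L2 M \<Longrightarrow> f \<in> borel_measurable M"
  and L2_square_integrable: "f \<in> L2 M \<Longrightarrow> integrable M (\<lambda>x. (f x)\<^sup>2)"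
  by (auto simp: L2_def)

lemma L2_mult_integrable:
  assumes "f \<in> L2 M" "g \<in> L2 M"
  shows "integrable M (\<lambda>x. f x * g x)"
proof (rule Bochner_Integration.integrable_bound)
  show "integrable M (\<lambda>x. (f x)\<^sup>2 + (g x)\<^sup>2)" using assms by (auto simp: L2_def)
  have "\<bar>a * b\<bar> \<le> a\<^sup>2 + b\<^sup>2" for a b :: real
    using sum_squares_bound[of "\<bar>a\<bar>" "\<bar>b\<bar>"] abs_ge_zero[of "a * b"]
    unfolding abs_mult power2_abs by linarith
  then show "AE x in M. norm (f x * g x) \<le> norm ((f x)\<^sup>2 + (g x)\<^sup>2)" by auto
qed (use assms in \<open>auto simp: L2_def\<close>)

lemma L2_lin:
  assumes "f \<in> L2 M" "g \<in> L2 M"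
  shows "(\<lambda>x. a * f x + b * g x) \<in> L2 M"
proof -
  have "integrable M (\<lambda>x. a\<^sup>2 * (f x)\<^sup>2 + 2 * a * b * (f x * g x) + b\<^sup>2 * (g x)\<^sup>2)"
    using assms L2_mult_integrable[OF assms] by (auto simp: L2_def)
  then have "integrable M (\<lambda>x. (a * f x + b * g x)\<^sup>2)"
    by (simp add: power2_eq_square algebra_simps)
  then show ?thesis using assms by (auto simp: L2_def)
qed

lemma L2_diff: "f \<in> L2 M \<Longrightarrow> g \<in> L2 M \<Longrightarrow> (\<lambda>x. f x - g x) \<in> L2 M"
  using L2_lin[of f M g 1 "-1"] by simp

lemma L2_scale: "f \<in> L2 M \<Longrightarrow> (\<lambda>x. a * f x) \<in> L2 M"
  using L2_lin[of f M f a 0] by simp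

lemma L2_dominated:
  assumes "f \<in> borel_measurable M" "g \<in> L2 M" "AE x in M. \<bar>f x\<bar> \<le> \<bar>g x\<bar>"
  shows "f \<in> L2 M"
proof -
  have "integrable M (\<lambda>x. (f x)\<^sup>2)"
    by (rule Bochner_Integration.integrable_bound[OF L2_square_integrable[OF assms(2)]])
      (use assms in \<open>auto simp: abs_le_square_iff\<close>)
  then show ?thesis using assms by (auto simp: L2_def)
qed

lemma semi_inner_L2: "semi_inner (L2 M) (\<lambda>a f b g x. a * f x + b * g x) (L2_inner M)"
proof
  fix a b f g h assume "f \<in> L2 M" "g \<in> L2 M" "h \<in> L2 M"
  then show "L2_inner M (\<lambda>x. a * f x + b * g x) h = a * L2_inner M f h + b * L2_inner M g h"
    using L2_mult_integrable[of f M h] L2_mult_integrable[of g M h]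
    by (simp add: L2_inner_def distrib_right mult.assoc)
qed (auto simp: L2_lin L2_inner_def mult.commute)

lemma L2_norm_nonneg: "0 \<le> L2_norm M f"
  by (simp add: L2_norm_def L2_inner_def)

lemma L2_norm_square: "(L2_norm M f)\<^sup>2 = (\<integral>x. (f x)\<^sup>2 \<partial>M)"
  by (simp add: L2_norm_def L2_inner_def power2_eq_square)

lemma L2_Cauchy_Schwarz:
  assumes "f \<in> L2 M" "g \<in> L2 M"
  shows "\<bar>L2_inner M f g\<bar> \<le> L2_norm M f * L2_norm M g"
  using semi_inner.Cauchy_Schwarz[OF semi_inner_L2 assms] by (simp add: L2_norm_def)

lemma L2_triangle:
  assumes "f \<in> L2 M" "g \<in> L2 M"
  shows "L2_norm M (\<lambda>x. a * f x + b * g x) \<le> \<bar>a\<bar> * L2_norm M f + \<bar>b\<bar> * L2_norm M g"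
  using semi_inner.triangle[OF semi_inner_L2 assms, of a b] by (simp add: L2_norm_def)

lemma L2_norm_mono:
  assumes "f \<in> borel_measurable M" "g \<in> L2 M" "AE x in M. \<bar>f x\<bar> \<le> \<bar>g x\<bar>"
  shows "L2_norm M f \<le> L2_norm M g"
proof -
  have "(\<integral>x. (f x)\<^sup>2 \<partial>M) \<le> (\<integral>x. (g x)\<^sup>2 \<partial>M)"
    by (rule integral_mono_AE)
      (use assms L2_dominated[OF assms] in \<open>auto simp: L2_def abs_le_square_iff\<close>)
  then show ?thesis by (simp add: L2_norm_def L2_inner_def power2_eq_square)
qed

lemma L2_norm_cong_AE:
  assumes "f \<in> borel_measurable M" "g \<in> borel_measurable M" "AE x in M. f x = g x"
  shows "L2_norm M f = L2_norm M g"
proof -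
  have "(\<integral>x. f x * f x \<partial>M) = (\<integral>x. g x * g x \<partial>M)"
    by (rule integral_cong_AE) (use assms in auto)
  then show ?thesis by (simp add: L2_norm_def L2_inner_def)
qed

lemma L2_norm_commute: "L2_norm M (\<lambda>x. f x - g x) = L2_norm M (\<lambda>x. g x - f x)"
  by (simp add: L2_norm_def L2_inner_def algebra_simps)

lemma L2_norm_diff_triangle:
  assumes "f \<in> L2 M" "g \<in> L2 M" "h \<in> L2 M"
  shows "L2_norm M (\<lambda>x. f x - h x) \<le> L2_norm M (\<lambda>x. f x - g x) + L2_norm M (\<lambda>x. g x - h x)"
  using L2_triangle[OF L2_diff[OF assms(1,2)] L2_diff[OF assms(2,3)], of 1 1] by simp

lemma L2_norm_le_add_diff:
  assumes "f \<in> L2 M" "g \<in> L2 M"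
  shows "L2_norm M f \<le> L2_norm M g + L2_norm M (\<lambda>x. f x - g x)"
  using L2_triangle[OF assms(2) L2_diff[OF assms], of 1 1] by simp

section \<open>The heat semigroup\<close>

lemma nonincreasing_of_Dini_derivative:
  fixes \<phi> :: "real \<Rightarrow> real"
  assumes cont: "continuous_on {0..} \<phi>" and "0 \<le> T"
    and Dini: "\<And>t e. 0 \<le> t \<Longrightarrow> 0 < e \<Longrightarrow> \<forall>\<^sub>F h in at_right 0. \<phi> (t + h) \<le> \<phi> t + e * h"
  shows "\<phi> T \<le> \<phi> 0"
proof (rule field_le_epsilon)
  fix e' :: real assume "e' > 0"
  define e where "e = e' / (T + 1)"
  have e: "e > 0" "e * T \<le> e'" using \<open>e' > 0\<close> \<open>0 \<le> T\<close> by (auto simp: e_def field_simps)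
  define S where "S = {0..T} \<inter> (\<lambda>t. \<phi> t - e * t) -` {..\<phi> 0}"
  have "continuous_on {0..T} (\<lambda>t. \<phi> t - e * t)"
    by (intro continuous_intros continuous_on_subset[OF cont]) auto
  then have "closed S"
    unfolding S_def by (intro continuous_closed_preimage) auto
  moreover have "bounded S"
    unfolding S_def by (rule bounded_subset[of "{0..T}"]) auto
  moreover have "0 \<in> S" using \<open>0 \<le> T\<close> by (simp add: S_def)
  ultimately obtain s where s: "s \<in> S" and s_max: "\<And>t. t \<in> S \<Longrightarrow> t \<le> s"
    using compact_attains_sup[of S] compact_eq_bounded_closed by auto
  have "s = T"
  proof (rule ccontr)
    assume "s \<noteq> T"
    then have sT: "0 \<le> s" "s < T" using s by (auto simp: S_def)
    have "\<forall>\<^sub>F h in at_right 0. h < T - s"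
      using sT by (intro eventually_at_rightI[of 0 "T - s"]) auto
    then have "\<forall>\<^sub>F h in at_right 0. 0 < h \<and> h < T - s \<and> \<phi> (s + h) \<le> \<phi> s + e * h"
      using Dini[OF sT(1) e(1)] eventually_at_right_less[of 0] by eventually_elim auto
    then obtain h where h: "0 < h" "h < T - s" "\<phi> (s + h) \<le> \<phi> s + e * h"
      using eventually_happens'[OF trivial_limit_at_right_real] by blast
    have "s + h \<in> S" using s h sT by (auto simp: S_def algebra_simps)
    then show False using s_max h(1) by fastforce
  qed
  then show "\<phi> T \<le> \<phi> 0 + e'" using s e by (auto simp: S_def)
qed

context dirichlet_form
begin

lemma dom_in_L2: "f \<in> D \<Longrightarrow> f \<in> L2 M"
  using dom_L2 by blast

lemma dom_diff: "f \<in> D \<Longrightarrow> g \<in> D \<Longrightarrow> (\<lambda>x. f x - g x) \<in> D"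
  using dom_linear[of f g 1 "-1"] by simp

lemma semi_inner_dom:
  assumes "0 \<le> l"
  shows "semi_inner D (\<lambda>a f b g x. a * f x + b * g x) (\<lambda>f g. E f g + l * L2_inner M f g)"
proof
  fix a b f g h assume "f \<in> D" "g \<in> D" "h \<in> D"
  then show "E (\<lambda>x. a * f x + b * g x) h + l * L2_inner M (\<lambda>x. a * f x + b * g x) h
    = a * (E f h + l * L2_inner M f h) + b * (E g h + l * L2_inner M g h)"
    by (simp add: form_linear semi_inner.B_lin[OF semi_inner_L2] dom_in_L2 algebra_simps)
qed (use assms in \<open>auto simp: dom_linear form_sym form_nonneg dom_in_L2
      semi_inner.B_sym[OF semi_inner_L2] semi_inner.B_nonneg[OF semi_inner_L2]\<close>)

lemma semi_inner_energy: "semi_inner D (\<lambda>a f b g x. a * f x + b * g x) E"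
  using semi_inner_dom[of 0] by simp

end

text \<open>A Dirichlet form on the compact space with its heat semigroup and a jointly continuous heat
  kernel. That the semigroup is contractive or Markovian is not part of the assumptions.\<close>

locale heat_flow =
  compact_metric_prob M + dirichlet_form M D E +
  L2_semigroup_generated M "laplacian M D E" P + heat_kernel M P p
  for M :: "'a::metric_space measure" and D E P p
begin

lemma L2_const: "(\<lambda>_. c) \<in> L2 M"
  by (simp add: L2_def)

lemma L2_integrable: "f \<in> L2 M \<Longrightarrow> integrable M f"
  using L2_mult_integrable[OF _ L2_const, of f 1] by simp

lemma L2_abs: "f \<in> L2 M \<Longrightarrow> (\<lambda>x. \<bar>f x\<bar>) \<in> L2 M"
  using L2_measurable[of f M] by (auto intro: L2_dominated[of _ _ f])

lemma integral_abs_le_L2_norm: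
  assumes "f \<in> L2 M"
  shows "(\<integral>x. \<bar>f x\<bar> \<partial>M) \<le> L2_norm M f"
proof -
  have "\<bar>L2_inner M (\<lambda>x. \<bar>f x\<bar>) (\<lambda>_. 1)\<bar> \<le> L2_norm M (\<lambda>x. \<bar>f x\<bar>) * L2_norm M (\<lambda>_. 1)"
    by (intro L2_Cauchy_Schwarz L2_abs L2_const assms)
  then show ?thesis by (simp add: L2_norm_def L2_inner_def prob_space)
qed

text \<open>The element \<open>u\<close> is the value of the resolvent \<open>l (l - \<Delta>)\<^sup>-\<^sup>1 g\<close>, obtained from the Riesz representation of
  \<open>v \<mapsto> l \<langle>g, v\<rangle>\<close> in the form domain. Testing the equation with \<open>u - g\<close> shows that it tends to \<open>g\<close>
  when \<open>l\<close> tends to infinity.\<close>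

lemma resolvent_approximation:
  assumes g: "g \<in> D" and l: "1 \<le> l"
  shows "\<exists>u w. (u, w) \<in> laplacian M D E \<and> l * (L2_norm M (\<lambda>x. u x - g x))\<^sup>2 \<le> E g g"
proof -
  define B where "B f h = E f h + l * L2_inner M f h" for f h
  have gL: "g \<in> L2 M" using g dom_in_L2 by blast
  interpret B: semi_inner D "\<lambda>a f b g x. a * f x + b * g x" B
    unfolding B_def using semi_inner_dom l by simp
  have L2_le_B: "L2_norm M f \<le> sqrt (B f f)" if "f \<in> D" for f
  proof -
    have "0 \<le> E f f" "0 \<le> L2_inner M f f"
      using that form_nonneg by (auto simp: L2_inner_def)
    then have "L2_inner M f f \<le> B f f"
      unfolding B_def using l mult_right_mono[of 1 l "L2_inner M f f"] by linarith
    then show ?thesis by (simp add: L2_norm_def)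
  qed
  have "\<exists>u\<in>D. \<forall>v\<in>D. B u v = l * L2_inner M g v"
  proof (rule B.Riesz_representation)
    show "D \<noteq> {}" using g by blast
    show "l * L2_inner M g (\<lambda>x. a * f x + b * h x) = a * (l * L2_inner M g f) + b * (l * L2_inner M g h)"
      if "f \<in> D" "h \<in> D" for a b f h
      using that semi_inner.B_lin[OF semi_inner_L2, of f M h g a b] gL dom_in_L2 L2_lin[of f M h a b]
        semi_inner.B_sym[OF semi_inner_L2, of g M] by (simp add: algebra_simps)
    show "\<bar>l * L2_inner M g f\<bar> \<le> (l * L2_norm M g) * sqrt (B f f)" if "f \<in> D" for f
    proof -
      have "\<bar>L2_inner M g f\<bar> \<le> L2_norm M g * L2_norm M f"
        using L2_Cauchy_Schwarz gL dom_in_L2 that by blast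
      also have "\<dots> \<le> L2_norm M g * sqrt (B f f)"
        by (intro mult_left_mono L2_le_B that L2_norm_nonneg)
      finally show ?thesis using l by (simp add: abs_mult)
    qed
  next
    fix u :: "nat \<Rightarrow> 'a \<Rightarrow> real"
    assume u: "\<forall>n. u n \<in> D"
      and Cau: "\<forall>e>0. \<exists>N. \<forall>m\<ge>N. \<forall>n\<ge>N.
        sqrt (B (\<lambda>x. 1 * u m x + -1 * u n x) (\<lambda>x. 1 * u m x + -1 * u n x)) < e"
    have le: "form_norm M E f \<le> sqrt (B f f)" "sqrt (B f f) \<le> sqrt l * form_norm M E f" if "f \<in> D" for f
    proof -
      have "0 \<le> E f f" "0 \<le> L2_inner M f f"
        using that form_nonneg by (auto simp: L2_inner_def)
      then have "E f f + L2_inner M f f \<le> B f f" "B f f \<le> l * (E f f + L2_inner M f f)"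
        unfolding B_def using l mult_right_mono[of 1 l "L2_inner M f f"] mult_right_mono[of 1 l "E f f"]
        by (auto simp: algebra_simps)
      then show "form_norm M E f \<le> sqrt (B f f)" "sqrt (B f f) \<le> sqrt l * form_norm M E f"
        by (auto simp: form_norm_def simp flip: real_sqrt_mult)
    qed
    have "\<forall>e>0. \<exists>N. \<forall>m\<ge>N. \<forall>n\<ge>N. form_norm M E (\<lambda>x. u m x - u n x) < e"
      using Cau le(1)[OF dom_diff] u by simp (meson le_less_trans)
    then obtain f where f: "f \<in> D" "(\<lambda>n. form_norm M E (\<lambda>x. u n x - f x)) \<longlonglongrightarrow> 0"
      using form_closed[OF u] by blast
    have "(\<lambda>n. sqrt l * form_norm M E (\<lambda>x. u n x - f x)) \<longlonglongrightarrow> 0"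
      using tendsto_mult_right_zero[OF f(2)] by simp
    then have "(\<lambda>n. sqrt (B (\<lambda>x. u n x - f x) (\<lambda>x. u n x - f x))) \<longlonglongrightarrow> 0"
    proof (rule Lim_null_comparison[rotated], intro always_eventually allI)
      fix n
      have "(\<lambda>x. u n x - f x) \<in> D" using u f dom_diff by blast
      from le(2)[OF this] B.B_nonneg[OF this]
      show "norm (sqrt (B (\<lambda>x. u n x - f x) (\<lambda>x. u n x - f x))) \<le> sqrt l * form_norm M E (\<lambda>x. u n x - f x)"
        by simp
    qed
    then show "\<exists>f\<in>D. (\<lambda>n. sqrt (B (\<lambda>x. 1 * u n x + -1 * f x) (\<lambda>x. 1 * u n x + -1 * f x))) \<longlonglongrightarrow> 0"
      using f(1) by auto
  qed
  then obtain u where u: "u \<in> D" and eq: "\<And>v. v \<in> D \<Longrightarrow> B u v = l * L2_inner M g v" by blast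
  have uL: "u \<in> L2 M" using u dom_in_L2 by blast
  define w where "w x = l * (u x - g x)" for x
  have wL: "w \<in> L2 M" unfolding w_def using L2_scale[OF L2_diff[OF uL gL]] by blast
  have Euv: "E u v = - L2_inner M v w" if "v \<in> D" for v
  proof -
    have v: "v \<in> L2 M" using that dom_in_L2 by blast
    have "L2_inner M w v = l * L2_inner M u v - l * L2_inner M g v"
      using semi_inner.B_lin[OF semi_inner_L2 uL gL v, of l "-l"] by (simp add: w_def[abs_def] algebra_simps)
    then show ?thesis using eq[OF that] semi_inner.B_sym[OF semi_inner_L2 v wL] by (simp add: B_def)
  qed
  define d where "d x = u x - g x" for x
  have d: "d \<in> D" unfolding d_def[abs_def] using dom_diff[OF u g] .
  have "L2_inner M d w = l * (L2_norm M d)\<^sup>2"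
    unfolding L2_norm_square by (simp add: L2_inner_def w_def d_def power2_eq_square mult.left_commute)
  moreover have "E u d = E d d + E g d"
    using form_linear[OF d g d, of 1 1] by (simp add: d_def[abs_def])
  moreover have "0 \<le> E d d + E g d + E g g"
  proof -
    interpret E: semi_inner D "\<lambda>a f b g x. a * f x + b * g x" E
      by (rule semi_inner_energy)
    have "0 \<le> E d d + 2 * E d g + E g g"
      using E.B_nonneg[OF E.lin_in[OF d g, of 1 1]] E.B_quadratic[OF d g, of 1 1] by simp
    then show ?thesis using form_nonneg[OF d] form_nonneg[OF g] form_sym[OF d g] by linarith
  qed
  ultimately have "l * (L2_norm M d)\<^sup>2 \<le> E g g" using Euv[OF d] by linarith
  then show ?thesis using u wL Euv unfolding laplacian_def d_def[abs_def] by blast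
qed

lemma laplacian_dom_dense:
  assumes "g \<in> L2 M" "0 < e"
  shows "\<exists>u w. (u, w) \<in> laplacian M D E \<and> L2_norm M (\<lambda>x. g x - u x) < e"
proof -
  obtain f where f: "f \<in> D" "L2_norm M (\<lambda>x. g x - f x) < e / 2"
    using dom_dense[OF assms(1), of "e / 2"] assms(2) by auto
  \<comment> \<open>large enough for the error bound \<open>E f f / l\<close> of the resolvent\<close>
  define l where "l = 1 + E f f / (e / 2)\<^sup>2"
  have E: "0 \<le> E f f" using f form_nonneg by blast
  have "(e / 2)\<^sup>2 > 0" using assms(2) by simp
  then have l: "1 \<le> l" "E f f < l * (e / 2)\<^sup>2"
    unfolding l_def using E by (auto simp: distrib_right simp del: power_divide)
  obtain u w where u: "(u, w) \<in> laplacian M D E" "l * (L2_norm M (\<lambda>x. u x - f x))\<^sup>2 \<le> E f f"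
    using resolvent_approximation[OF f(1) l(1)] by blast
  have "l * (L2_norm M (\<lambda>x. u x - f x))\<^sup>2 < l * (e / 2)\<^sup>2" using u(2) l(2) by linarith
  then have "(L2_norm M (\<lambda>x. u x - f x))\<^sup>2 < (e / 2)\<^sup>2"
    using l(1) by (simp only: mult_less_cancel_left_pos)
  then have "L2_norm M (\<lambda>x. u x - f x) < e / 2"
    by (rule power2_less_imp_less) (use assms(2) in simp)
  moreover have "u \<in> L2 M" using u(1) dom_in_L2 by (auto simp: laplacian_def)
  ultimately have "L2_norm M (\<lambda>x. g x - u x) < e"
    using L2_norm_diff_triangle[OF assms(1) dom_in_L2[OF f(1)], of u] f(2) L2_norm_commute[of M f u]
    by linarith
  then show ?thesis using u(1) by blast
qed

text \<open>By joint continuity the heat kernel is bounded for times in a compact subset of the open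
  half-line. This gives local boundedness of the semigroup away from time zero, and hence left
  continuity of its orbits, before contractivity is known.\<close>

lemma P_locally_bounded:
  assumes "0 < a"
  shows "\<exists>K\<ge>0. \<forall>t\<in>{a..b}. \<forall>f\<in>L2 M. L2_norm M (P t f) \<le> K * L2_norm M f"
proof -
  have "compact ({a..b} \<times> (UNIV :: 'a set) \<times> (UNIV :: 'a set))"
    by (intro compact_Times compact_space compact_Icc)
  then have "compact ((\<lambda>(t, x, y). p t x y) ` ({a..b} \<times> UNIV \<times> UNIV))"
    using assms by (intro compact_continuous_image continuous_on_subset[OF kernel_cont]) auto
  then obtain K where "K > 0" and K: "\<And>z. z \<in> (\<lambda>(t, x, y). p t x y) ` ({a..b} \<times> UNIV \<times> UNIV) \<Longrightarrow> \<bar>z\<bar> \<le> K"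
    using compact_imp_bounded bounded_pos real_norm_def by metis
  have p_le: "\<bar>p t x y\<bar> \<le> K" if "t \<in> {a..b}" for t x y
    using that by (intro K) (auto intro!: image_eqI[of _ _ "(t, x, y)"])
  have "L2_norm M (P t f) \<le> K * L2_norm M f" if t: "t \<in> {a..b}" and f: "f \<in> L2 M" for t f
  proof -
    have t0: "0 < t" using t assms by auto
    have bound: "\<bar>\<integral>y. p t x y * f y \<partial>M\<bar> \<le> K * L2_norm M f" for x
    proof -
      have "\<bar>\<integral>y. p t x y * f y \<partial>M\<bar> \<le> (\<integral>y. K * \<bar>f y\<bar> \<partial>M)"
      proof (rule order_trans[OF integral_abs_bound integral_mono'])
        show "integrable M (\<lambda>y. K * \<bar>f y\<bar>)" using L2_integrable[OF f] by simp
        show "\<bar>p t x y * f y\<bar> \<le> K * \<bar>f y\<bar>" for y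
          using p_le[OF t, of x y] by (simp add: abs_mult mult_right_mono)
      qed (use \<open>K > 0\<close> in auto)
      also have "\<dots> \<le> K * L2_norm M f"
        using integral_abs_le_L2_norm[OF f] \<open>K > 0\<close> by simp
      finally show ?thesis .
    qed
    have "AE x in M. \<bar>P t f x\<bar> \<le> \<bar>K * L2_norm M f\<bar>"
      using kernel[OF t0 f] by eventually_elim (use bound abs_ge_self order_trans in metis)
    then have "L2_norm M (P t f) \<le> L2_norm M (\<lambda>_. K * L2_norm M f)"
      using t0 f P_L2[of t f] by (intro L2_norm_mono L2_const) (auto simp: L2_measurable)
    also have "\<dots> = K * L2_norm M f"
      using \<open>K > 0\<close> L2_norm_nonneg[of M f] by (simp add: L2_norm_def[of M "\<lambda>_. _"] L2_inner_def prob_space)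
    finally show ?thesis .
  qed
  then show ?thesis using \<open>K > 0\<close> by (intro exI[of _ K]) auto
qed

lemma P_diff:
  assumes "0 \<le> t" "f \<in> L2 M" "g \<in> L2 M"
  shows "AE x in M. P t (\<lambda>y. f y - g y) x = P t f x - P t g x"
  using P_linear[OF assms, of 1 "-1"] by simp

lemma P_orbit_diff:
  assumes "0 \<le> s" "0 \<le> h" "f \<in> L2 M"
  shows "L2_norm M (\<lambda>x. P (s + h) f x - P s f x) = L2_norm M (P s (\<lambda>x. P h f x - f x))"
proof (rule L2_norm_cong_AE)
  show "AE x in M. P (s + h) f x - P s f x = P s (\<lambda>x. P h f x - f x) x"
    using P_add[OF assms] P_diff[OF assms(1) P_L2[OF assms(2,3)] assms(3)] by eventually_elim simp
  show "(\<lambda>x. P (s + h) f x - P s f x) \<in> borel_measurable M" "P s (\<lambda>x. P h f x - f x) \<in> borel_measurable M"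
    by (intro L2_measurable L2_diff P_L2; use assms in simp)+
qed

lemma P_orbit_continuous:
  assumes f: "f \<in> L2 M" and t: "0 \<le> t"
  shows "((\<lambda>s. L2_norm M (\<lambda>x. P s f x - P t f x)) \<longlongrightarrow> 0) (at t within {0..})"
proof -
  have "filterlim (\<lambda>s. \<bar>s - t\<bar>) (at_right 0) (at t within {0..})"
    unfolding filterlim_at by (auto intro!: tendsto_eq_intros simp: eventually_at_filter)
  from filterlim_compose[OF P_cont[OF f] this]
  have lim: "((\<lambda>s. L2_norm M (\<lambda>x. P \<bar>s - t\<bar> f x - f x)) \<longlongrightarrow> 0) (at t within {0..})" .
  have "\<exists>a<t. \<exists>K. \<forall>r. a < r \<and> r \<le> t \<and> 0 \<le> r \<longrightarrow> (\<forall>g\<in>L2 M. L2_norm M (P r g) \<le> K * L2_norm M g)"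
  proof (cases "t = 0")
    case True
    obtain K where "\<forall>g\<in>L2 M. L2_norm M (P 0 g) \<le> K * L2_norm M g"
      using P_bounded[of 0] by auto
    then show ?thesis using True by (intro exI[of _ "-1"] conjI exI[of _ K]) (auto dest: antisym)
  next
    case False
    then have "0 < t / 2" using t by simp
    then obtain K where "\<forall>r\<in>{t / 2..t}. \<forall>g\<in>L2 M. L2_norm M (P r g) \<le> K * L2_norm M g"
      using P_locally_bounded by meson
    then show ?thesis using \<open>0 < t / 2\<close> by (intro exI[of _ "t / 2"] conjI exI[of _ K]) auto
  qed
  then obtain a K where "a < t"
    and K: "\<And>r g. a < r \<Longrightarrow> r \<le> t \<Longrightarrow> 0 \<le> r \<Longrightarrow> g \<in> L2 M \<Longrightarrow> L2_norm M (P r g) \<le> K * L2_norm M g"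
    by blast
  have "\<forall>\<^sub>F s in at t within {0..}. a < s"
    using order_tendstoD(1)[OF tendsto_ident_at \<open>a < t\<close>] .
  moreover have "\<forall>\<^sub>F s in at t within {0..}. 0 \<le> s"
    by (simp add: eventually_at_filter)
  ultimately have "\<forall>\<^sub>F s in at t within {0..}. norm (L2_norm M (\<lambda>x. P s f x - P t f x))
      \<le> K * L2_norm M (\<lambda>x. P \<bar>s - t\<bar> f x - f x)"
  proof eventually_elim
    case (elim s)
    define r where "r = min s t"
    have r: "a < r" "r \<le> t" "0 \<le> r" using elim \<open>a < t\<close> t by (auto simp: r_def)
    have "L2_norm M (\<lambda>x. P s f x - P t f x) = L2_norm M (\<lambda>x. P (r + \<bar>s - t\<bar>) f x - P r f x)"
    proof (cases "s \<le> t")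
      case True
      then show ?thesis by (subst L2_norm_commute) (simp add: r_def)
    qed (simp add: r_def)
    also have "\<dots> = L2_norm M (P r (\<lambda>x. P \<bar>s - t\<bar> f x - f x))"
      using P_orbit_diff r(3) f by simp
    also have "\<dots> \<le> K * L2_norm M (\<lambda>x. P \<bar>s - t\<bar> f x - f x)"
      using r f by (intro K L2_diff P_L2) auto
    finally show ?case by (simp add: L2_norm_nonneg)
  qed
  then show ?thesis
    by (rule Lim_null_comparison) (use tendsto_mult_right_zero[OF lim] in simp)
qed

lemma laplacian_P_invariant:
  assumes uw: "(u, w) \<in> laplacian M D E" and t: "0 \<le> t"
  shows "(P t u, P t w) \<in> laplacian M D E"
proof -
  have u: "u \<in> L2 M" and w: "w \<in> L2 M"
    and lim: "((\<lambda>h. L2_norm M (\<lambda>x. (P h u x - u x) / h - w x)) \<longlongrightarrow> 0) (at_right 0)"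
    using uw by (auto simp: P_generator)
  obtain K where K: "\<And>g. g \<in> L2 M \<Longrightarrow> L2_norm M (P t g) \<le> K * L2_norm M g"
    using P_bounded[OF t] by blast
  have "\<forall>\<^sub>F h in at_right 0. norm (L2_norm M (\<lambda>x. (P h (P t u) x - P t u x) / h - P t w x))
      \<le> K * L2_norm M (\<lambda>x. (P h u x - u x) / h - w x)"
    using eventually_at_right_less[of 0]
  proof eventually_elim
    case (elim h)
    define q where "q x = P h u x - u x" for x
    have h: "0 \<le> h" using elim by simp
    have q: "q \<in> L2 M" unfolding q_def[abs_def] using h u by (intro L2_diff P_L2)
    have "AE x in M. P t (\<lambda>x. (1 / h) * q x + (-1) * w x) x = (1 / h) * P t q x + (-1) * P t w x"
      using P_linear[OF t q w] .
    moreover have "AE x in M. P t q x = P t (P h u) x - P t u x"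
      unfolding q_def[abs_def] by (intro P_diff t P_L2 h u)
    moreover have "AE x in M. P (t + h) u x = P t (P h u) x" "AE x in M. P (h + t) u x = P h (P t u) x"
      using P_add h t u by blast+
    ultimately have "AE x in M. (P h (P t u) x - P t u x) / h - P t w x = P t (\<lambda>x. q x / h - w x) x"
      by eventually_elim (simp add: add.commute diff_divide_distrib)
    moreover have L: "(\<lambda>x. q x / h - w x) \<in> L2 M"
      using L2_lin[OF q w, of "1 / h" "-1"] by simp
    moreover have "(\<lambda>x. (P h (P t u) x - P t u x) / h - P t w x) \<in> borel_measurable M"
      using L2_measurable[OF P_L2[OF h P_L2[OF t u]]] L2_measurable[OF P_L2[OF t u]]
        L2_measurable[OF P_L2[OF t w]] by measurable
    ultimately have "L2_norm M (\<lambda>x. (P h (P t u) x - P t u x) / h - P t w x)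
        = L2_norm M (P t (\<lambda>x. q x / h - w x))"
      using L2_measurable[OF P_L2[OF t L]] by (intro L2_norm_cong_AE)
    also have "\<dots> \<le> K * L2_norm M (\<lambda>x. q x / h - w x)" by (rule K[OF L])
    finally show ?case by (simp add: L2_norm_nonneg q_def)
  qed
  then have "((\<lambda>h. L2_norm M (\<lambda>x. (P h (P t u) x - P t u x) / h - P t w x)) \<longlongrightarrow> 0) (at_right 0)"
    by (rule Lim_null_comparison) (use tendsto_mult_right_zero[OF lim] in simp)
  then show ?thesis using P_L2[OF t u] P_L2[OF t w] by (simp add: P_generator)
qed

text \<open>Here \<open>N v\<close> plays the role of \<open>v - \<Pi> v\<close>, where \<open>\<Pi>\<close> is the projection onto a closed convex set
  of functions, and the conclusion says that the distance to this set decreases along the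
  semigroup. The derivative of the squared distance is at most \<open>2 \<langle>N v, \<Delta> v\<rangle> = - 2 E(v, N v)\<close>, which is
  nonpositive; the assumption \<open>proj\<close> yields the upper bound for the difference quotients.\<close>

lemma P_decreases_residual:
  fixes N :: "real \<Rightarrow> real"
  assumes N0: "N 0 = 0"
    and lip: "\<And>x y. \<bar>N x - N y\<bar> \<le> \<bar>x - y\<bar>"
    and proj: "\<And>x y. (N y)\<^sup>2 \<le> (N x + (y - x))\<^sup>2"
    and energy: "\<And>v. v \<in> D \<Longrightarrow> (\<lambda>x. N (v x)) \<in> D \<and> 0 \<le> E v (\<lambda>x. N (v x))"
    and g: "g \<in> L2 M" and t: "0 \<le> t"
  shows "L2_norm M (\<lambda>x. N (P t g x)) \<le> L2_norm M (\<lambda>x. N (g x))"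
proof -
  have "1-lipschitz_on UNIV N"
    using lip by (auto simp: lipschitz_on_def dist_real_def)
  then have [measurable]: "N \<in> borel_measurable borel"
    by (intro borel_measurable_continuous_onI lipschitz_on_continuous_on)
  have NL: "(\<lambda>x. N (f x)) \<in> L2 M" if "f \<in> L2 M" for f
  proof (rule L2_dominated[OF _ that])
    have [measurable]: "f \<in> borel_measurable M" using that L2_measurable by blast
    show "(\<lambda>x. N (f x)) \<in> borel_measurable M" by measurable
    show "AE x in M. \<bar>N (f x)\<bar> \<le> \<bar>f x\<bar>" using lip[of _ 0] by (simp add: N0)
  qed
  have N_close: "L2_norm M (\<lambda>x. N (f x)) \<le> L2_norm M (\<lambda>x. N (h x)) + L2_norm M (\<lambda>x. f x - h x)"
    if f: "f \<in> L2 M" and h: "h \<in> L2 M" for f h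
  proof -
    have "L2_norm M (\<lambda>x. N (f x) - N (h x)) \<le> L2_norm M (\<lambda>x. f x - h x)"
      using lip by (intro L2_norm_mono L2_measurable L2_diff NL f h) auto
    then show ?thesis using L2_norm_le_add_diff[OF NL[OF f] NL[OF h]] by linarith
  qed
  have dom: "L2_norm M (\<lambda>x. N (P t u x)) \<le> L2_norm M (\<lambda>x. N (u x))" if uw: "(u, w) \<in> laplacian M D E" for u w
  proof -
    have u: "u \<in> L2 M" using uw by (auto simp: P_generator)
    define \<phi> where "\<phi> s = (L2_norm M (\<lambda>x. N (P s u x)))\<^sup>2" for s
    have "\<phi> t \<le> \<phi> 0"
    proof (rule nonincreasing_of_Dini_derivative[OF _ t])
      have "((\<lambda>s. L2_norm M (\<lambda>x. N (P s u x))) \<longlongrightarrow> L2_norm M (\<lambda>x. N (P r u x))) (at r within {0..})"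
        if r: "0 \<le> r" for r
      proof (rule Lim_transform2[OF tendsto_const Lim_null_comparison[OF _ P_orbit_continuous[OF u r]]])
        have "\<forall>\<^sub>F s in at r within {0..}. 0 \<le> s" by (simp add: eventually_at_filter)
        then show "\<forall>\<^sub>F s in at r within {0..}. norm (L2_norm M (\<lambda>x. N (P r u x)) - L2_norm M (\<lambda>x. N (P s u x)))
          \<le> L2_norm M (\<lambda>x. P s u x - P r u x)"
        proof eventually_elim
          case (elim s)
          show ?case
            using N_close[OF P_L2[OF elim u] P_L2[OF r u]] N_close[OF P_L2[OF r u] P_L2[OF elim u]]
              L2_norm_commute[of M "P r u" "P s u"] by auto
        qed
      qed
      then show "continuous_on {0..} \<phi>"
        unfolding \<phi>_def by (intro continuous_on_power) (auto simp: continuous_on_def)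
    next
      fix s e :: real assume s: "0 \<le> s" and e: "0 < e"
      define v where "v = P s u"
      define z where "z = P s w"
      have vz: "(v, z) \<in> laplacian M D E"
        unfolding v_def z_def using laplacian_P_invariant[OF uw s] .
      then have v: "v \<in> L2 M" "v \<in> D" and z: "z \<in> L2 M"
        and Ev: "\<And>y. y \<in> D \<Longrightarrow> E v y = - L2_inner M y z"
        using dom_in_L2 by (auto simp: laplacian_def)
      define \<rho> where "\<rho> h = L2_norm M (\<lambda>x. (P h v x - v x) / h - z x)" for h
      have \<rho>: "(\<rho> \<longlongrightarrow> 0) (at_right 0)" using vz by (simp add: P_generator \<rho>_def[abs_def])
      let ?n = "L2_norm M (\<lambda>x. N (v x))"
      have "((\<lambda>h. 2 * ?n * \<rho> h + h * (L2_norm M z + \<rho> h)\<^sup>2) \<longlongrightarrow> 2 * ?n * 0 + 0 * (L2_norm M z + 0)\<^sup>2) (at_right 0)"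
        by (intro tendsto_intros \<rho>)
      then have "\<forall>\<^sub>F h in at_right 0. 2 * ?n * \<rho> h + h * (L2_norm M z + \<rho> h)\<^sup>2 < e"
        using order_tendstoD(2)[OF _ e] by simp
      then show "\<forall>\<^sub>F h in at_right 0. \<phi> (s + h) \<le> \<phi> s + e * h"
        using eventually_at_right_less[of 0]
      proof eventually_elim
        case (elim h)
        then have h: "0 < h" "0 \<le> h" by auto
        define q where "q x = P h v x - v x" for x
        define r where "r x = q x / h - z x" for x
        have q: "q \<in> L2 M" unfolding q_def[abs_def] by (intro L2_diff P_L2 h v)
        have r: "r \<in> L2 M" unfolding r_def[abs_def] using L2_lin[OF q z, of "1 / h" "-1"] by simp
        have q_eq: "q = (\<lambda>x. h * z x + h * r x)" using h by (auto simp: r_def field_simps)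
        have \<rho>h: "\<rho> h = L2_norm M r" by (simp add: \<rho>_def r_def[abs_def] q_def)
        have q_le: "L2_norm M q \<le> h * (L2_norm M z + \<rho> h)"
          using L2_triangle[OF z r, of h h] h by (simp add: q_eq \<rho>h distrib_left)
        have "L2_inner M (\<lambda>x. N (v x)) q = h * L2_inner M (\<lambda>x. N (v x)) z + h * L2_inner M (\<lambda>x. N (v x)) r"
          using semi_inner.B_lin[OF semi_inner_L2 z r NL[OF v(1)], of h h]
            semi_inner.B_sym[OF semi_inner_L2 NL[OF v(1)]] q z r by (simp add: q_eq)
        moreover have "L2_inner M (\<lambda>x. N (v x)) z \<le> 0"
          using energy[OF v(2)] Ev[of "\<lambda>x. N (v x)"] by simp
        moreover have "L2_inner M (\<lambda>x. N (v x)) r \<le> ?n * \<rho> h"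
          using L2_Cauchy_Schwarz[OF NL[OF v(1)] r] by (simp add: \<rho>h)
        ultimately have inner_le: "L2_inner M (\<lambda>x. N (v x)) q \<le> h * (?n * \<rho> h)"
          using mult_nonneg_nonpos[OF h(2)] mult_left_mono[OF _ h(2)] by (smt (verit))
        have "AE x in M. P (h + s) u x = P h v x"
          unfolding v_def using P_add[OF h(2) s u] .
        then have "AE x in M. N (P (s + h) u x) = N (P h v x)"
          by eventually_elim (simp add: add.commute)
        then have "L2_norm M (\<lambda>x. N (P (s + h) u x)) = L2_norm M (\<lambda>x. N (P h v x))"
          using s h by (intro L2_norm_cong_AE L2_measurable NL P_L2 v u) auto
        also have "\<dots> \<le> L2_norm M (\<lambda>x. 1 * N (v x) + 1 * q x)"
          using proj by (intro L2_norm_mono L2_measurable NL P_L2 h v L2_lin q)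
            (auto simp: q_def abs_le_square_iff)
        finally have "\<phi> (s + h) \<le> (L2_norm M (\<lambda>x. 1 * N (v x) + 1 * q x))\<^sup>2"
          unfolding \<phi>_def by (intro power_mono L2_norm_nonneg)
        also have "\<dots> = ?n\<^sup>2 + 2 * L2_inner M (\<lambda>x. N (v x)) q + (L2_norm M q)\<^sup>2"
          using semi_inner.B_quadratic[OF semi_inner_L2 NL[OF v(1)] q, of 1 1]
          unfolding L2_norm_square by (simp add: L2_inner_def power2_eq_square)
        also have "\<dots> \<le> ?n\<^sup>2 + 2 * (h * (?n * \<rho> h)) + (h * (L2_norm M z + \<rho> h))\<^sup>2"
          using inner_le power_mono[OF q_le L2_norm_nonneg, of 2] by linarith
        also have "\<dots> = \<phi> s + (2 * ?n * \<rho> h + h * (L2_norm M z + \<rho> h)\<^sup>2) * h"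
          by (simp add: \<phi>_def v_def power2_eq_square algebra_simps)
        also have "\<dots> \<le> \<phi> s + e * h"
          using elim by (intro add_left_mono mult_right_mono) auto
        finally show ?case .
      qed
    qed
    moreover have "AE x in M. N (P 0 u x) = N (u x)"
      using P_0[OF u] by eventually_elim simp
    then have "L2_norm M (\<lambda>x. N (P 0 u x)) = L2_norm M (\<lambda>x. N (u x))"
      by (intro L2_norm_cong_AE L2_measurable NL P_L2 u) auto
    ultimately show ?thesis
      by (simp add: \<phi>_def L2_norm_nonneg)
  qed
  obtain K where K: "\<And>g. g \<in> L2 M \<Longrightarrow> L2_norm M (P t g) \<le> K * L2_norm M g"
    using P_bounded[OF t] by blast
  show ?thesis
  proof (rule field_le_epsilon)
    fix e :: real assume "e > 0"
    then have "e / (\<bar>K\<bar> + 1) > 0" by simp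
    then obtain u w where uw: "(u, w) \<in> laplacian M D E" and d: "L2_norm M (\<lambda>x. g x - u x) < e / (\<bar>K\<bar> + 1)"
      using laplacian_dom_dense[OF g] by blast
    have u: "u \<in> L2 M" using uw by (auto simp: P_generator)
    let ?d = "L2_norm M (\<lambda>x. g x - u x)"
    have "AE x in M. P t g x - P t u x = P t (\<lambda>x. g x - u x) x"
      using P_diff[OF t g u] by eventually_elim simp
    then have "L2_norm M (\<lambda>x. P t g x - P t u x) = L2_norm M (P t (\<lambda>x. g x - u x))"
      by (intro L2_norm_cong_AE L2_measurable L2_diff P_L2 t g u)
    also have "\<dots> \<le> K * ?d" by (intro K L2_diff g u)
    finally have Pd: "L2_norm M (\<lambda>x. P t g x - P t u x) \<le> \<bar>K\<bar> * ?d"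
      using mult_right_mono[OF abs_ge_self[of K] L2_norm_nonneg] by (rule order_trans)
    have "L2_norm M (\<lambda>x. N (P t g x)) \<le> L2_norm M (\<lambda>x. N (P t u x)) + \<bar>K\<bar> * ?d"
      using N_close[OF P_L2[OF t g] P_L2[OF t u]] Pd by linarith
    also have "\<dots> \<le> L2_norm M (\<lambda>x. N (g x)) + (\<bar>K\<bar> + 1) * ?d"
      using dom[OF uw] N_close[OF u g] L2_norm_commute[of M u g] by (simp add: distrib_right)
    also have "\<dots> \<le> L2_norm M (\<lambda>x. N (g x)) + e"
      using d by (simp add: field_simps)
    finally show "L2_norm M (\<lambda>x. N (P t g x)) \<le> L2_norm M (\<lambda>x. N (g x)) + e" .
  qed
qed

lemma P_contraction:
  assumes "g \<in> L2 M" "0 \<le> t"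
  shows "L2_norm M (P t g) \<le> L2_norm M g"
  using P_decreases_residual[of "\<lambda>x. x", OF _ _ _ _ assms] form_nonneg by simp

text \<open>The unit contraction \<open>\<Pi>\<close> does not move the points \<open>\<Pi> v + s (v - \<Pi> v)\<close>, so by the Markov
  property \<open>E\<close> does not decrease from \<open>\<Pi> v\<close> in the direction \<open>v - \<Pi> v\<close>.\<close>

lemma unit_residual_energy:
  fixes c N :: "real \<Rightarrow> real"
  defines "c \<equiv> \<lambda>x. min (max x 0) 1" and "N \<equiv> \<lambda>x. x - c x"
  assumes v: "v \<in> D"
  shows "(\<lambda>x. N (v x)) \<in> D \<and> 0 \<le> E v (\<lambda>x. N (v x))"
proof -
  define k where "k x = c (v x)" for x
  define d where "d x = v x - k x" for x
  have k: "k \<in> D" using markov[OF v] by (simp add: k_def[abs_def] c_def)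
  have d: "d \<in> D" unfolding d_def[abs_def] using dom_diff[OF v k] .
  interpret E: semi_inner D "\<lambda>a f b g x. a * f x + b * g x" E
    by (rule semi_inner_energy)
  have step: "0 \<le> 2 * E k d + s * E d d" if s: "0 < s" "s \<le> 1" for s
  proof -
    define w where "w x = 1 * k x + s * d x" for x
    have w: "w \<in> D" unfolding w_def[abs_def] by (intro dom_linear k d)
    have fixed: "c (c a + s * (a - c a)) = c a" for a
    proof -
      consider "a < 0" | "0 \<le> a \<and> a \<le> 1" | "1 < a" by linarith
      then show ?thesis
      proof cases
        case 1
        then have "s * a < 0" using s by (simp add: mult_pos_neg)
        then show ?thesis using 1 by (simp add: c_def)
      next
        case 3
        then have "0 < s * (a - 1)" using s by simp
        then show ?thesis using 3 by (simp add: c_def)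
      qed (simp add: c_def)
    qed
    have "c (w x) = k x" for x
      using fixed[of "v x"] by (simp only: w_def k_def d_def mult_1)
    then have "(\<lambda>x. min (max (w x) 0) 1) = k"
      by (simp add: c_def fun_eq_iff)
    then have "E k k \<le> E w w" using markov[OF w] by simp
    also have "\<dots> = E k k + 2 * s * E k d + s\<^sup>2 * E d d"
      using E.B_quadratic[OF k d, of 1 s] by (simp add: w_def[abs_def])
    finally have "0 \<le> s * (2 * E k d + s * E d d)" by (simp add: power2_eq_square algebra_simps)
    then show ?thesis using s by (simp add: zero_le_mult_iff)
  qed
  have "0 \<le> 2 * E k d"
  proof (rule tendsto_lowerbound)
    show "((\<lambda>s. 2 * E k d + s * E d d) \<longlongrightarrow> 2 * E k d) (at_right 0)"
      by (auto intro!: tendsto_eq_intros)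
    show "\<forall>\<^sub>F s in at_right 0. 0 \<le> 2 * E k d + s * E d d"
      using step by (intro eventually_at_rightI[of 0 1]) auto
  qed simp
  moreover have "E v d = E d d + E k d"
    using form_linear[OF d k d, of 1 1] by (simp add: d_def[abs_def])
  ultimately have "0 \<le> E v d" using form_nonneg[OF d] by linarith
  then show ?thesis using d by (simp add: d_def[abs_def] k_def N_def)
qed

lemma P_Markov:
  assumes g: "g \<in> L2 M" and bound: "AE x in M. 0 \<le> g x \<and> g x \<le> 1" and t: "0 \<le> t"
  shows "AE x in M. P t g x \<le> 1"
proof -
  define N :: "real \<Rightarrow> real" where "N = (\<lambda>x. x - min (max x 0) 1)"
  have [measurable]: "N \<in> borel_measurable borel" by (simp add: N_def)
  have Pg: "P t g \<in> L2 M" using P_L2[OF t g] .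
  have [measurable]: "g \<in> borel_measurable M" "P t g \<in> borel_measurable M"
    using g Pg L2_measurable by auto
  have "L2_norm M (\<lambda>x. N (P t g x)) \<le> L2_norm M (\<lambda>x. N (g x))"
  proof (rule P_decreases_residual[OF _ _ _ _ g t])
    have "\<bar>N y\<bar> \<le> \<bar>N x + (y - x)\<bar>" for x y by (auto simp: N_def min_def max_def abs_if)
    then show "(N y)\<^sup>2 \<le> (N x + (y - x))\<^sup>2" for x y by (simp add: abs_le_square_iff)
    show "\<bar>N x - N y\<bar> \<le> \<bar>x - y\<bar>" for x y by (auto simp: N_def min_def max_def abs_if)
    show "(\<lambda>x. N (v x)) \<in> D \<and> 0 \<le> E v (\<lambda>x. N (v x))" if "v \<in> D" for v
      unfolding N_def using unit_residual_energy[OF that] .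
  qed (simp add: N_def)
  also have "AE x in M. N (g x) = 0"
    using bound by eventually_elim (simp add: N_def)
  then have "L2_norm M (\<lambda>x. N (g x)) = L2_norm M (\<lambda>_. 0)"
    by (intro L2_norm_cong_AE) auto
  finally have "(\<integral>x. (N (P t g x))\<^sup>2 \<partial>M) = 0"
    using L2_norm_nonneg[of M "\<lambda>x. N (P t g x)"] L2_norm_square[of M "\<lambda>x. N (P t g x)"]
    by (simp add: L2_norm_def[of M "\<lambda>_. 0"] L2_inner_def)
  moreover have "(\<lambda>x. N (P t g x)) \<in> L2 M"
    by (rule L2_dominated[OF _ Pg]) (auto simp: N_def)
  ultimately have "AE x in M. (N (P t g x))\<^sup>2 = 0"
    using integral_nonneg_eq_0_iff_AE[of M "\<lambda>x. (N (P t g x))\<^sup>2"] by (simp add: L2_square_integrable)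
  then show ?thesis by eventually_elim (auto simp: N_def min_def max_def split: if_splits)
qed

end

section \<open>Time averages of a semigroup on a Hilbert space\<close>

lemma semigroup_orbit_continuous:
  fixes T :: "real \<Rightarrow> 'h::real_normed_vector \<Rightarrow> 'h"
  assumes "semigroup_generated A T"
    and bound: "\<And>t v. 0 \<le> t \<Longrightarrow> t \<le> 1 \<Longrightarrow> norm (T t v) \<le> C * norm v"
  shows "continuous_on {0..1} (\<lambda>t. T t \<eta>)"
proof -
  interpret semigroup_generated A T by fact
  have "\<exists>d>0. \<forall>t'\<in>{0..1}. dist t' t < d \<longrightarrow> dist (T t' \<eta>) (T t \<eta>) < e"
    if t: "t \<in> {0..1}" and e: "0 < e" for t e
  proof -
    have e': "0 < e / (\<bar>C\<bar> + 1)" using e by simp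
    from tendstoD[OF T_cont[of \<eta>] this] obtain d where d: "0 < d"
      and d_less: "\<And>h. 0 < h \<Longrightarrow> h < d \<Longrightarrow> dist (T h \<eta>) \<eta> < e / (\<bar>C\<bar> + 1)"
      by (auto simp: eventually_at_right_field)
    have "dist (T t' \<eta>) (T t \<eta>) < e" if t': "t' \<in> {0..1}" "dist t' t < d" for t'
    proof -
      define r where "r = min t' t"
      define h where "h = \<bar>t' - t\<bar>"
      have r: "0 \<le> r" "r \<le> 1" and h: "0 \<le> h" "h < d"
        using t t' by (auto simp: r_def h_def dist_real_def)
      have h_less: "norm (T h \<eta> - \<eta>) < e / (\<bar>C\<bar> + 1)"
        using d_less[of h] h e' T_0[of \<eta>] by (cases "h = 0") (auto simp: dist_norm)
      have "dist (T t' \<eta>) (T t \<eta>) = norm (T (r + h) \<eta> - T r \<eta>)"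
        by (cases "t' \<le> t") (auto simp: r_def h_def dist_norm norm_minus_commute)
      also have "\<dots> = norm (T r (T h \<eta> - \<eta>))"
        using T_add r h bounded_linear.linear[OF T_bounded_linear[OF r(1)]] by (simp add: linear_diff)
      also have "\<dots> \<le> C * norm (T h \<eta> - \<eta>)" using bound r by blast
      also have "\<dots> \<le> (\<bar>C\<bar> + 1) * norm (T h \<eta> - \<eta>)" by (intro mult_right_mono) auto
      also have "\<dots> < e" using h_less by (simp add: field_simps)
      finally show ?thesis .
    qed
    then show ?thesis using d by blast
  qed
  then show ?thesis unfolding continuous_on_iff by blast
qed

text \<open>The vector \<open>V\<close> is the integral of the orbit over \<open>{0..s}\<close>, defined weakly by the Riesz
  representation. It lies in the domain of the generator, which is why time averages regularize.\<close>

lemma weak_orbit_integral: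
  fixes T :: "real \<Rightarrow> 'h::{real_inner, complete_space} \<Rightarrow> 'h"
  assumes sg: "semigroup_generated A T"
    and bound: "\<And>t v. 0 \<le> t \<Longrightarrow> t \<le> 1 \<Longrightarrow> norm (T t v) \<le> C * norm v"
    and s: "0 < s" "s < 1"
  shows "\<exists>V. (\<forall>\<nu>. inner V \<nu> = integral {0..s} (\<lambda>t. inner (T t \<eta>) \<nu>)) \<and> (V, T s \<eta> - \<eta>) \<in> A"
proof -
  interpret semigroup_generated A T by fact
  have cont: "continuous_on {0..1} (\<lambda>t. T t \<eta>)" by (rule semigroup_orbit_continuous[OF sg bound])
  have integ: "(\<lambda>t. inner (T t \<eta>) \<nu>) integrable_on {a..b}" if "0 \<le> a" "b \<le> 1" for a b \<nu>
    by (intro integrable_continuous_real continuous_intros continuous_on_subset[OF cont])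
      (use that in auto)
  have "\<exists>V. \<forall>\<nu>. inner V \<nu> = integral {0..s} (\<lambda>t. inner (T t \<eta>) \<nu>)"
  proof (rule Hilbert_Riesz)
    show "integral {0..s} (\<lambda>t. inner (T t \<eta>) (a *\<^sub>R x + b *\<^sub>R y))
        = a * integral {0..s} (\<lambda>t. inner (T t \<eta>) x) + b * integral {0..s} (\<lambda>t. inner (T t \<eta>) y)" for a b x y
    proof -
      have "integral {0..s} (\<lambda>t. a * inner (T t \<eta>) x + b * inner (T t \<eta>) y)
          = integral {0..s} (\<lambda>t. a * inner (T t \<eta>) x) + integral {0..s} (\<lambda>t. b * inner (T t \<eta>) y)"
        using s integ[of 0 s] by (intro Henstock_Kurzweil_Integration.integral_add integrable_on_mult_right) auto
      then show ?thesis by (simp add: inner_add_right)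
    qed
    show "\<bar>integral {0..s} (\<lambda>t. inner (T t \<eta>) x)\<bar> \<le> (s * (C * norm \<eta>)) * norm x" for x
    proof -
      have "norm (integral {0..s} (\<lambda>t. inner (T t \<eta>) x)) \<le> (C * norm \<eta> * norm x) * (s - 0)"
      proof (rule integral_bound)
        show "continuous_on {0..s} (\<lambda>t. inner (T t \<eta>) x)"
          using s by (intro continuous_intros continuous_on_subset[OF cont]) auto
        fix t assume t: "t \<in> {0..s}"
        have "norm (inner (T t \<eta>) x) \<le> norm (T t \<eta>) * norm x"
          using Cauchy_Schwarz_ineq2 by simp
        also have "\<dots> \<le> C * norm \<eta> * norm x"
          using bound[of t \<eta>] t s by (intro mult_right_mono) auto
        finally show "norm (inner (T t \<eta>) x) \<le> C * norm \<eta> * norm x" .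
      qed (use s in auto)
      then show ?thesis by (simp add: mult.commute mult.left_commute)
    qed
  qed
  then obtain V where V: "\<And>\<nu>. inner V \<nu> = integral {0..s} (\<lambda>t. inner (T t \<eta>) \<nu>)" by blast
  have shift: "inner (T h V - V) \<nu> = integral {s..s + h} (\<lambda>t. inner (T t \<eta>) \<nu>) - integral {0..h} (\<lambda>t. inner (T t \<eta>) \<nu>)"
    if h: "0 < h" "h < s" "h < 1 - s" for h \<nu>
  proof -
    interpret Th: bounded_linear "T h" using T_bounded_linear h by simp
    obtain K where K: "\<And>x. norm (T h x) \<le> norm x * K" using Th.bounded by blast
    \<comment> \<open>the adjoint of \<open>T h\<close> applied to \<open>\<nu>\<close>\<close>
    have "\<exists>\<nu>'. \<forall>x. inner \<nu>' x = inner (T h x) \<nu>"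
    proof (rule Hilbert_Riesz)
      show "\<bar>inner (T h x) \<nu>\<bar> \<le> (K * norm \<nu>) * norm x" for x
      proof -
        have "\<bar>inner (T h x) \<nu>\<bar> \<le> norm (T h x) * norm \<nu>" by (rule Cauchy_Schwarz_ineq2)
        also have "\<dots> \<le> (norm x * K) * norm \<nu>" using K by (intro mult_right_mono) auto
        finally show ?thesis by (simp add: mult.commute mult.left_commute)
      qed
    qed (simp add: Th.add Th.scaleR inner_add_left)
    then obtain \<nu>' where \<nu>': "\<And>x. inner (T h x) \<nu> = inner x \<nu>'" by (metis inner_commute)
    have "inner (T h V) \<nu> = integral {0..s} (\<lambda>t. inner (T h (T t \<eta>)) \<nu>)"
      unfolding \<nu>' V ..
    also have "\<dots> = integral {0..s} ((\<lambda>t. inner (T t \<eta>) \<nu>) \<circ> ((+) h))"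
      using h by (intro Henstock_Kurzweil_Integration.integral_cong) (simp add: T_add)
    also have "\<dots> = integral {h..s + h} (\<lambda>t. inner (T t \<eta>) \<nu>)"
      using integral_shift_Icc_real[of 0 s "\<lambda>t. inner (T t \<eta>) \<nu>" h] by simp
    also have "\<dots> = integral {h..s} (\<lambda>t. inner (T t \<eta>) \<nu>) + integral {s..s + h} (\<lambda>t. inner (T t \<eta>) \<nu>)"
      using h s by (intro Henstock_Kurzweil_Integration.integral_combine[symmetric] integ) auto
    finally show ?thesis
      using Henstock_Kurzweil_Integration.integral_combine[of 0 h s "\<lambda>t. inner (T t \<eta>) \<nu>"] integ[of 0 s \<nu>] h s
      by (simp add: inner_diff_left V)
  qed
  have near: "\<forall>\<^sub>F h in at_right 0. \<forall>t\<in>{r..r + h}. norm (T t \<eta> - T r \<eta>) \<le> e"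
    if r: "0 \<le> r" "r < 1" and e: "0 < e" for r e
  proof -
    obtain d where d: "0 < d" "\<And>t. t \<in> {0..1} \<Longrightarrow> dist t r < d \<Longrightarrow> dist (T t \<eta>) (T r \<eta>) < e"
      using cont e r unfolding continuous_on_iff by (metis atLeastAtMost_iff less_imp_le)
    show ?thesis
      using d r by (intro eventually_at_rightI[of 0 "min d (1 - r)"])
        (auto simp: dist_norm dist_real_def intro!: less_imp_le)
  qed
  have "((\<lambda>h. (T h V - V) /\<^sub>R h) \<longlongrightarrow> T s \<eta> - \<eta>) (at_right 0)"
  proof (rule tendstoI)
    fix e :: real assume "0 < e"
    then have e: "0 < e / 3" by simp
    have "\<forall>\<^sub>F h in at_right 0. h < s"
      using s by (intro eventually_at_rightI[of 0 s]) auto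
    moreover have "\<forall>\<^sub>F h in at_right 0. h < 1 - s"
      using s by (intro eventually_at_rightI[of 0 "1 - s"]) auto
    ultimately show "\<forall>\<^sub>F h in at_right 0. dist ((T h V - V) /\<^sub>R h) (T s \<eta> - \<eta>) < e"
      using near[OF order_refl zero_less_one e] near[OF less_imp_le[OF s(1)] s(2) e]
        eventually_at_right_less[of 0]
    proof eventually_elim
      case (elim h)
      then have h: "0 < h" "h < s" "h < 1 - s" by auto
      have piece: "\<bar>integral {r..r + h} (\<lambda>t. inner (T t \<eta>) \<nu>) - h * inner (T r \<eta>) \<nu>\<bar> \<le> h * (e / 3 * norm \<nu>)"
        if r: "0 \<le> r" "r + h \<le> 1" and *: "\<forall>t\<in>{r..r + h}. norm (T t \<eta> - T r \<eta>) \<le> e / 3" for r \<nu>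
      proof -
        have "norm (integral {r..r + h} (\<lambda>t. inner (T t \<eta> - T r \<eta>) \<nu>)) \<le> (e / 3 * norm \<nu>) * (r + h - r)"
        proof (rule integral_bound)
          show "continuous_on {r..r + h} (\<lambda>t. inner (T t \<eta> - T r \<eta>) \<nu>)"
            using r by (intro continuous_intros continuous_on_subset[OF cont]) auto
          fix t assume "t \<in> {r..r + h}"
          then have "norm (T t \<eta> - T r \<eta>) * norm \<nu> \<le> e / 3 * norm \<nu>"
            using * by (intro mult_right_mono) auto
          then show "norm (inner (T t \<eta> - T r \<eta>) \<nu>) \<le> e / 3 * norm \<nu>"
            using Cauchy_Schwarz_ineq2[of "T t \<eta> - T r \<eta>" \<nu>] by simp
        qed (use h in auto)
        moreover have "integral {r..r + h} (\<lambda>t. inner (T t \<eta> - T r \<eta>) \<nu>)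
            = integral {r..r + h} (\<lambda>t. inner (T t \<eta>) \<nu>) - h * inner (T r \<eta>) \<nu>"
          using h Henstock_Kurzweil_Integration.integral_diff[OF integ[OF r] integrable_const_ivl,
              of \<nu> "inner (T r \<eta>) \<nu>"]
          by (simp add: inner_diff_left)
        ultimately show ?thesis by (simp add: mult.commute)
      qed
      define x where "x = T h V - V - h *\<^sub>R (T s \<eta> - \<eta>)"
      have "inner x x = inner (T h V - V) x - h * (inner (T s \<eta>) x - inner \<eta> x)"
        by (subst (1) x_def) (simp only: inner_diff_left inner_scaleR_left)
      also have "\<dots> = (integral {s..s + h} (\<lambda>t. inner (T t \<eta>) x) - h * inner (T s \<eta>) x)
          - (integral {0..0 + h} (\<lambda>t. inner (T t \<eta>) x) - h * inner (T 0 \<eta>) x)"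
        by (simp add: shift[OF h] T_0 right_diff_distrib)
      also have "\<dots> \<le> h * (e / 3 * norm x) + h * (e / 3 * norm x)"
      proof -
        have "\<bar>integral {s..s + h} (\<lambda>t. inner (T t \<eta>) x) - h * inner (T s \<eta>) x\<bar> \<le> h * (e / 3 * norm x)"
          using elim s by (intro piece) auto
        moreover have "\<bar>integral {0..0 + h} (\<lambda>t. inner (T t \<eta>) x) - h * inner (T 0 \<eta>) x\<bar> \<le> h * (e / 3 * norm x)"
          using elim s by (intro piece) auto
        ultimately show ?thesis by linarith
      qed
      finally have "norm x * norm x \<le> (2 * h * (e / 3)) * norm x"
        by (simp add: power2_norm_eq_inner[symmetric] power2_eq_square mult_ac)
      then have "norm x \<le> 2 * h * (e / 3)"
        using h \<open>0 < e\<close> by (cases "x = 0") auto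
      moreover have "0 < h * e" using h \<open>0 < e\<close> by simp
      ultimately have "norm x < h * e" by linarith
      then have "norm x / h < e" using h by (simp add: field_simps)
      moreover have "(T h V - V) /\<^sub>R h - (T s \<eta> - \<eta>) = x /\<^sub>R h"
        using h by (simp add: x_def scaleR_diff_right)
      ultimately show ?case using h by (simp add: dist_norm divide_inverse mult.commute)
    qed
  qed
  then show ?thesis using V T_generator by blast
qed

section \<open>Gradients and the fibre norm\<close>

text \<open>A Dirichlet form with carre du champ together with its space of one-forms, decomposed as a
  direct integral. No semigroup is involved.\<close>

locale form_calculus =
  compact_metric_prob M + dirichlet_form M D E + carre_du_champ M D E \<Gamma> +
  one_forms M D \<Gamma> tens + direct_integral_decomposition M F S D \<Gamma> tens \<Phi>
  for M :: "'a::metric_space measure" and D E \<Gamma>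
    and tens :: "('a \<Rightarrow> real) \<Rightarrow> ('a \<Rightarrow> real) \<Rightarrow> 'h::{real_inner, complete_space}"
    and F :: "'a \<Rightarrow> 'k::{real_inner, complete_space} set" and S \<Phi>
begin

lemma Phi_section: "\<Phi> \<eta> \<in> S"
  using Phi_L2 by (auto simp: L2_sections_def)

lemma section_inner_measurable:
  assumes "\<xi> \<in> S" "\<zeta> \<in> S"
  shows "(\<lambda>x. inner (\<xi> x) (\<zeta> x)) \<in> borel_measurable M"
proof -
  have [measurable]: "(\<lambda>x. norm (\<xi> x)) \<in> borel_measurable M" "(\<lambda>x. norm (\<zeta> x)) \<in> borel_measurable M"
    "(\<lambda>x. norm (\<xi> x + \<zeta> x)) \<in> borel_measurable M"
    using section_norm[OF assms(1)] section_norm[OF assms(2)]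
      section_norm[OF section_linear[OF assms, of 1 1]] by auto
  show ?thesis unfolding dot_norm by measurable
qed

lemma section_scale:
  assumes "a \<in> borel_measurable M" "\<xi> \<in> S"
  shows "(\<lambda>x. a x *\<^sub>R \<xi> x) \<in> S"
proof (rule section_saturated)
  show "\<forall>x. a x *\<^sub>R \<xi> x \<in> F x"
    using section_fibre[OF assms(2)] fibre_subspace subspace_scale by blast
  show "\<forall>\<zeta>\<in>S. (\<lambda>x. inner (\<zeta> x) (a x *\<^sub>R \<xi> x)) \<in> borel_measurable M"
    using section_inner_measurable[OF _ assms(2)] assms(1) by (auto intro!: borel_measurable_times)
qed

lemma fibre_norm_L2: "(\<lambda>x. norm (\<Phi> \<eta> x)) \<in> L2 M"
  using Phi_L2[of \<eta>] section_norm by (auto simp: L2_sections_def L2_def)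

lemma fibre_norm_measurable [measurable]: "(\<lambda>x. norm (\<Phi> \<eta> x)) \<in> borel_measurable M"
  using fibre_norm_L2 L2_measurable by blast

lemma fibre_norm_integrable: "integrable M (\<lambda>x. norm (\<Phi> \<eta> x))"
  using fibre_norm_measurable L2_square_integrable[OF fibre_norm_L2]
  by (rule square_integrable_imp_integrable)

lemma norm_square_eq: "(norm \<eta>)\<^sup>2 = (\<integral>x. (norm (\<Phi> \<eta> x))\<^sup>2 \<partial>M)"
  using Phi_isometric[of \<eta> \<eta>] by (simp add: power2_norm_eq_inner)

lemma norm_eq_L2_norm: "norm \<eta> = L2_norm M (\<lambda>x. norm (\<Phi> \<eta> x))"
  using norm_square_eq[of \<eta>] L2_norm_square[of M "\<lambda>x. norm (\<Phi> \<eta> x)"] L2_norm_nonneg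
  by (metis norm_ge_zero power2_eq_iff_nonneg)

lemma fibre_inner_integrable: "integrable M (\<lambda>x. inner (\<Phi> \<eta> x) (\<Phi> \<zeta> x))"
  by (rule Bochner_Integration.integrable_bound[OF L2_mult_integrable[OF fibre_norm_L2[of \<eta>] fibre_norm_L2[of \<zeta>]]])
    (auto simp: section_inner_measurable Phi_section Cauchy_Schwarz_ineq2)

text \<open>Scaling by a measurable function is allowed as long as the product is bounded.\<close>

lemma fibre_scale_exists:
  assumes a: "a \<in> borel_measurable M" and bound: "\<And>x. \<bar>a x\<bar> * norm (\<Phi> \<zeta> x) \<le> K"
  shows "\<exists>\<eta>. AE x in M. \<Phi> \<eta> x = a x *\<^sub>R \<Phi> \<zeta> x"
proof (rule Phi_onto)
  note a [measurable]
  have [measurable]: "(\<lambda>x. norm (a x *\<^sub>R \<Phi> \<zeta> x)) \<in> borel_measurable M"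
    using section_norm section_scale[OF a Phi_section] by blast
  have "(norm (a x *\<^sub>R \<Phi> \<zeta> x))\<^sup>2 \<le> K\<^sup>2" for x
    using bound[of x] by (intro power_mono) auto
  then have "integrable M (\<lambda>x. (norm (a x *\<^sub>R \<Phi> \<zeta> x))\<^sup>2)"
    by (intro integrable_const_bound[of _ "K\<^sup>2"]) auto
  then show "(\<lambda>x. a x *\<^sub>R \<Phi> \<zeta> x) \<in> L2_sections M S"
    using section_scale[OF a Phi_section] by (simp add: L2_sections_def)
qed

text \<open>A one-form of fibre norm at most one in the direction of \<open>\<zeta>\<close>.\<close>

lemma fibre_direction_exists:
  "\<exists>\<eta>. (AE x in M. norm (\<Phi> \<eta> x) \<le> 1) \<and> inner \<zeta> \<eta> = (\<integral>x. norm (\<Phi> \<zeta> x) \<partial>M)"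
proof -
  have "\<exists>\<eta>. AE x in M. \<Phi> \<eta> x = (1 / norm (\<Phi> \<zeta> x)) *\<^sub>R \<Phi> \<zeta> x"
    by (rule fibre_scale_exists[of _ _ 1]) auto
  then obtain \<eta> where \<eta>: "AE x in M. \<Phi> \<eta> x = (1 / norm (\<Phi> \<zeta> x)) *\<^sub>R \<Phi> \<zeta> x" by blast
  have "AE x in M. inner (\<Phi> \<zeta> x) (\<Phi> \<eta> x) = norm (\<Phi> \<zeta> x)"
    using \<eta> by eventually_elim (simp add: power2_norm_eq_inner[symmetric] power2_eq_square)
  then have "inner \<zeta> \<eta> = (\<integral>x. norm (\<Phi> \<zeta> x) \<partial>M)"
    unfolding Phi_isometric[of \<zeta> \<eta>]
    by (intro integral_cong_AE section_inner_measurable Phi_section fibre_norm_measurable)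
  moreover have "AE x in M. norm (\<Phi> \<eta> x) \<le> 1"
    using \<eta> by eventually_elim simp
  ultimately show ?thesis by blast
qed

text \<open>The weak integral of forms with fibre norm at most \<open>C\<close>. It is tested against its own direction,
  restricted to the set where the claimed bound fails.\<close>

lemma weak_integral_fibre_bound:
  fixes u :: "real \<Rightarrow> 'h"
  assumes V: "\<And>\<nu>. inner V \<nu> = integral {0..s} (\<lambda>t. inner (u t) \<nu>)"
    and cont: "continuous_on {0..s} u"
    and bound: "\<And>t. t \<in> {0..s} \<Longrightarrow> AE x in M. norm (\<Phi> (u t) x) \<le> C"
    and "0 \<le> s" "0 \<le> C"
  shows "AE x in M. norm (\<Phi> V x) \<le> s * C"
proof -
  define b :: "'a \<Rightarrow> real" where "b x = (if norm (\<Phi> V x) > s * C then 1 else 0)" for x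
  have [measurable]: "b \<in> borel_measurable M" unfolding b_def by measurable
  have b01: "b x * b x = b x" "0 \<le> b x" "b x \<le> 1" for x by (auto simp: b_def)
  have b_int: "integrable M b" by (rule integrable_const_bound[of _ 1]) (auto simp: b_def)
  have "\<exists>\<nu>. AE x in M. \<Phi> \<nu> x = (b x / norm (\<Phi> V x)) *\<^sub>R \<Phi> V x"
    by (rule fibre_scale_exists[of _ _ 1]) (use b01 in auto)
  then obtain \<nu> where \<nu>: "AE x in M. \<Phi> \<nu> x = (b x / norm (\<Phi> V x)) *\<^sub>R \<Phi> V x" by blast
  have bV_int: "integrable M (\<lambda>x. b x * norm (\<Phi> V x))"
    by (rule Bochner_Integration.integrable_bound[OF fibre_norm_integrable[of V]])
      (auto simp: b_def)
  have "AE x in M. inner (\<Phi> V x) (\<Phi> \<nu> x) = b x * norm (\<Phi> V x)"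
    using \<nu> by eventually_elim (simp add: power2_norm_eq_inner[symmetric] power2_eq_square)
  then have eq: "inner V \<nu> = (\<integral>x. b x * norm (\<Phi> V x) \<partial>M)"
    unfolding Phi_isometric[of V \<nu>]
    by (intro integral_cong_AE section_inner_measurable Phi_section) auto
  have le: "inner (u t) \<nu> \<le> C * (\<integral>x. b x \<partial>M)" if t: "t \<in> {0..s}" for t
  proof -
    have "AE x in M. inner (\<Phi> (u t) x) (\<Phi> \<nu> x) \<le> C * b x"
      using \<nu> bound[OF t]
    proof eventually_elim
      case (elim x)
      have "inner (\<Phi> (u t) x) (\<Phi> \<nu> x) \<le> norm (\<Phi> (u t) x) * norm (\<Phi> \<nu> x)"
        by (rule norm_cauchy_schwarz)
      also have "\<dots> \<le> C * b x"
        using elim b01[of x] \<open>0 \<le> C\<close> by (intro mult_mono) auto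
      finally show ?case .
    qed
    then have "inner (u t) \<nu> \<le> (\<integral>x. C * b x \<partial>M)"
      unfolding Phi_isometric[of "u t" \<nu>]
      by (intro integral_mono_AE fibre_inner_integrable integrable_mult_right b_int)
    then show ?thesis by simp
  qed
  have "inner V \<nu> \<le> integral {0..s} (\<lambda>t. C * (\<integral>x. b x \<partial>M))"
    unfolding V using le cont
    by (intro integral_le integrable_continuous_real continuous_intros) auto
  then have "(\<integral>x. b x * norm (\<Phi> V x) \<partial>M) \<le> (\<integral>x. s * C * b x \<partial>M)"
    using \<open>0 \<le> s\<close> by (simp add: eq mult_ac)
  then have "(\<integral>x. b x * norm (\<Phi> V x) - s * C * b x \<partial>M) \<le> 0"
    using bV_int b_int by simp
  moreover have nonneg: "0 \<le> b x * norm (\<Phi> V x) - s * C * b x" for x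
    by (auto simp: b_def)
  ultimately have "(\<integral>x. b x * norm (\<Phi> V x) - s * C * b x \<partial>M) = 0"
    by (intro antisym Bochner_Integration.integral_nonneg) auto
  then have "AE x in M. b x * norm (\<Phi> V x) - s * C * b x = 0"
    using integral_nonneg_eq_0_iff_AE[of M "\<lambda>x. b x * norm (\<Phi> V x) - s * C * b x"] nonneg bV_int b_int
    by simp
  then show ?thesis by eventually_elim (auto simp: b_def split: if_splits)
qed

lemma Gamma_quadratic:
  assumes f: "f \<in> D" and g: "g \<in> D"
  shows "AE x in M. \<Gamma> (\<lambda>y. a * f y + b * g y) (\<lambda>y. a * f y + b * g y) x
    = a\<^sup>2 * \<Gamma> f f x + 2 * a * b * \<Gamma> f g x + b\<^sup>2 * \<Gamma> g g x"
proof -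
  let ?h = "\<lambda>y. a * f y + b * g y"
  have h: "?h \<in> D" by (intro dom_linear f g)
  show ?thesis
    using Gamma_linear[OF f g h, of a b] Gamma_linear[OF f g f, of a b] Gamma_linear[OF f g g, of a b]
      Gamma_sym[OF f h] Gamma_sym[OF g h] Gamma_sym[OF g f]
    by eventually_elim (simp add: algebra_simps power2_eq_square)
qed

text \<open>If \<open>A\<close>, \<open>B\<close>, \<open>C\<close> are the values of a positive semidefinite form \<open>Q\<close> on the pairs \<open>(a, a)\<close>, \<open>(a, f)\<close>,
  \<open>(f, f)\<close>, then \<open>A - 2 B\<close> is the increment of \<open>Q\<close> from \<open>f\<close> to \<open>f - a\<close>. Positivity enters only for
  two linear combinations with constant coefficients, so the estimate applies pointwise to \<open>\<Gamma>\<close>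
  outside a null set.\<close>

lemma quadratic_perturbation:
  fixes A B C \<delta> :: real
  assumes "0 < \<delta>" "0 \<le> A" "0 \<le> A + 2 * \<delta> * B + \<delta>\<^sup>2 * C" "0 \<le> A - 2 * \<delta> * B + \<delta>\<^sup>2 * C"
  shows "\<bar>A - 2 * B\<bar> \<le> (1 + 1 / \<delta>) * A + \<delta> * C"
proof -
  have "0 \<le> (A + 2 * \<delta> * B + \<delta>\<^sup>2 * C) / \<delta>" "0 \<le> (A - 2 * \<delta> * B + \<delta>\<^sup>2 * C) / \<delta>"
    using assms by auto
  then have "2 * B \<le> A / \<delta> + \<delta> * C" "- (2 * B) \<le> A / \<delta> + \<delta> * C"
    using assms(1) by (auto simp: field_simps power2_eq_square)
  then show ?thesis using assms(2) by (simp add: distrib_right abs_le_iff)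
qed

lemma cont_dom_diff: "f \<in> cont_dom D \<Longrightarrow> g \<in> cont_dom D \<Longrightarrow> (\<lambda>x. f x - g x) \<in> cont_dom D"
  by (auto simp: cont_dom_def dom_diff bounded_minus_comp intro!: continuous_on_diff)

lemma one_bounded_borel: "(\<lambda>_. 1) \<in> bounded_borel"
  by (auto simp: bounded_borel_def)

lemma norm_tens_one_diff:
  assumes f: "f \<in> cont_dom D" and g: "g \<in> cont_dom D"
  shows "(norm (tens f (\<lambda>_. 1) - tens g (\<lambda>_. 1)))\<^sup>2 = E (\<lambda>x. f x - g x) (\<lambda>x. f x - g x)"
proof -
  note fg = cont_dom_diff[OF f g]
  have "tens f (\<lambda>_. 1) - tens g (\<lambda>_. 1) = tens (\<lambda>x. f x - g x) (\<lambda>_. 1)"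
    using tens_linear_left[OF f g one_bounded_borel, of 1 "-1"] by simp
  then show ?thesis
    using tens_inner[OF fg fg one_bounded_borel one_bounded_borel] Gamma_integral[of "\<lambda>x. f x - g x"] fg
    by (simp add: power2_norm_eq_inner cont_dom_def)
qed

text \<open>Every element of the form domain has a gradient, with fibre norm \<open>sqrt (\<Gamma> f f)\<close>. Both \<open>\<Gamma> f f\<close>
  and the squared fibre norm of the gradient are \<open>L\<^sup>1\<close> limits of \<open>\<Gamma> u u\<close> for continuous \<open>u\<close> that
  converge to \<open>f\<close>.\<close>

lemma gradient_exists:
  assumes reg: "regular_form M D E" and f: "f \<in> D"
  shows "\<exists>\<zeta>. (f, \<zeta>) \<in> grad M D tens \<and> (AE x in M. norm (\<Phi> \<zeta> x) = sqrt (\<Gamma> f f x))"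
proof -
  have "\<exists>g\<in>cont_dom D. form_norm M E (\<lambda>x. f x - g x) < 1 / real (Suc n)" for n
    using reg f by (simp add: regular_form_def)
  then obtain u where u: "\<And>n. u n \<in> cont_dom D"
    and u_less: "\<And>n. form_norm M E (\<lambda>x. f x - u n x) < 1 / real (Suc n)"
    by metis
  have uD: "u n \<in> D" for n using u by (auto simp: cont_dom_def)
  define a where "a n x = f x - u n x" for n x
  have aD: "a n \<in> D" for n unfolding a_def[abs_def] by (intro dom_diff f uD)
  have a_le: "sqrt (E (a n) (a n)) \<le> 1 / real (Suc n)" "L2_norm M (a n) \<le> 1 / real (Suc n)" for n
  proof -
    have "0 \<le> E (a n) (a n)" "0 \<le> L2_inner M (a n) (a n)"
      using form_nonneg[OF aD] by (auto simp: L2_inner_def)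
    then have "sqrt (E (a n) (a n)) \<le> form_norm M E (a n)" "L2_norm M (a n) \<le> form_norm M E (a n)"
      by (auto simp: form_norm_def L2_norm_def)
    then show "sqrt (E (a n) (a n)) \<le> 1 / real (Suc n)" "L2_norm M (a n) \<le> 1 / real (Suc n)"
      using u_less[of n] unfolding a_def[abs_def] by linarith+
  qed
  have to0: "(\<lambda>n. 1 / real (Suc n)) \<longlonglongrightarrow> 0"
    using LIMSEQ_inverse_real_of_nat by (simp add: inverse_eq_divide)
  define z where "z n = tens (u n) (\<lambda>_. 1)" for n
  have z_close: "norm (z m - z n) \<le> 1 / real (Suc m) + 1 / real (Suc n)" for m n
  proof -
    interpret E: semi_inner D "\<lambda>a f b g x. a * f x + b * g x" E by (rule semi_inner_energy)
    have "norm (z m - z n) = sqrt (E (\<lambda>x. u m x - u n x) (\<lambda>x. u m x - u n x))"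
      using norm_tens_one_diff[OF u[of m] u[of n]] by (metis z_def norm_ge_zero real_sqrt_unique)
    also have "(\<lambda>x. u m x - u n x) = (\<lambda>x. (-1) * a m x + 1 * a n x)"
      by (auto simp: a_def)
    also have "sqrt (E (\<lambda>x. (-1) * a m x + 1 * a n x) (\<lambda>x. (-1) * a m x + 1 * a n x))
        \<le> 1 / real (Suc m) + 1 / real (Suc n)"
      using E.triangle[OF aD[of m] aD[of n], of "-1" 1] a_le(1)[of m] a_le(1)[of n] by linarith
    finally show ?thesis .
  qed
  have "Cauchy z"
    unfolding Cauchy_def
  proof (intro allI impI)
    fix e :: real assume "e > 0"
    then obtain N where N: "1 / real (Suc N) < e / 2"
      using reals_Archimedean[of "e / 2"] by (auto simp: inverse_eq_divide)
    have "dist (z m) (z n) < e" if "m \<ge> N" "n \<ge> N" for m n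
    proof -
      have "1 / real (Suc m) \<le> 1 / real (Suc N)" "1 / real (Suc n) \<le> 1 / real (Suc N)"
        using that by (auto simp: frac_le)
      then show ?thesis using z_close[of m n] N unfolding dist_norm by linarith
    qed
    then show "\<exists>N. \<forall>m\<ge>N. \<forall>n\<ge>N. dist (z m) (z n) < e" by blast
  qed
  then obtain \<zeta> where z_lim: "z \<longlonglongrightarrow> \<zeta>" using Cauchy_convergent convergent_def by blast
  have "(\<lambda>n. L2_norm M (\<lambda>x. u n x - f x)) \<longlonglongrightarrow> 0"
  proof (rule Lim_null_comparison[OF always_eventually to0], rule allI)
    show "norm (L2_norm M (\<lambda>x. u n x - f x)) \<le> 1 / real (Suc n)" for n
      using a_le(2)[of n] by (subst L2_norm_commute) (simp add: L2_norm_nonneg a_def[abs_def] del: of_nat_Suc)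
  qed
  then have grad: "(f, \<zeta>) \<in> grad M D tens"
    using z_lim u dom_in_L2[OF f] by (auto simp: grad_def z_def[abs_def])
  let ?q = "\<lambda>x. (norm (\<Phi> \<zeta> x))\<^sup>2"
  have q_int: "integrable M ?q" using L2_square_integrable[OF fibre_norm_L2] .
  have G_int: "integrable M (\<Gamma> f f)" using Gamma_L1[OF f f] .
  define I where "I = (\<integral>x. \<bar>\<Gamma> f f x - ?q x\<bar> \<partial>M)"
  \<comment> \<open>compare \<open>\<Gamma> f f\<close> and the squared fibre norm of \<open>\<zeta>\<close> with the common value \<open>\<Gamma> (u n) (u n)\<close>\<close>
  have I_le: "I \<le> (1 + 1 / \<delta>) * (E (a n) (a n) + (norm (z n - \<zeta>))\<^sup>2) + \<delta> * (E f f + (norm \<zeta>)\<^sup>2)"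
    if \<delta>: "0 < \<delta>" for \<delta> n
  proof -
    let ?r = "\<lambda>x. (norm (\<Phi> (z n - \<zeta>) x))\<^sup>2"
    have r_int: "integrable M ?r" using L2_square_integrable[OF fibre_norm_L2] .
    have a_int: "integrable M (\<Gamma> (a n) (a n))" using Gamma_L1[OF aD aD] .
    have u_eq: "u n = (\<lambda>x. (-1) * a n x + 1 * f x)" by (auto simp: a_def)
    have sum_D: "(\<lambda>x. 1 * a n x + c * f x) \<in> D" for c by (intro dom_linear aD f)
    have "AE x in M. \<Gamma> (u n) (u n) x = \<Gamma> (a n) (a n) x - 2 * \<Gamma> (a n) f x + \<Gamma> f f x"
      using Gamma_quadratic[OF aD[of n] f, of "-1" 1] unfolding u_eq[symmetric] by eventually_elim simp
    moreover have "AE x in M. (norm (\<Phi> (z n) x))\<^sup>2 = \<Gamma> (u n) (u n) x"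
      using Phi_fibre[OF u u one_bounded_borel one_bounded_borel, of n n]
      by eventually_elim (simp add: power2_norm_eq_inner z_def)
    moreover have "AE x in M. \<Phi> (z n - \<zeta>) x = \<Phi> (z n) x - \<Phi> \<zeta> x"
      using Phi_linear[of 1 "z n" "-1" \<zeta>] by eventually_elim simp
    moreover note Gamma_nonneg[OF aD[of n]] Gamma_nonneg[OF sum_D[of \<delta>]] Gamma_nonneg[OF sum_D[of "-\<delta>"]]
      Gamma_quadratic[OF aD[of n] f, of 1 \<delta>] Gamma_quadratic[OF aD[of n] f, of 1 "-\<delta>"]
    ultimately have "AE x in M. \<bar>\<Gamma> f f x - ?q x\<bar>
        \<le> (1 + 1 / \<delta>) * (\<Gamma> (a n) (a n) x + ?r x) + \<delta> * (\<Gamma> f f x + ?q x)"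
    proof eventually_elim
      case (elim x)
      have 1: "\<bar>\<Gamma> (a n) (a n) x - 2 * \<Gamma> (a n) f x\<bar> \<le> (1 + 1 / \<delta>) * \<Gamma> (a n) (a n) x + \<delta> * \<Gamma> f f x"
        using elim(4-) by (intro quadratic_perturbation \<delta>) auto
      define y where "y = \<Phi> (z n - \<zeta>) x"
      define k where "k = \<Phi> \<zeta> x"
      have 2: "\<bar>inner y y - 2 * (- inner y k)\<bar> \<le> (1 + 1 / \<delta>) * inner y y + \<delta> * inner k k"
      proof (intro quadratic_perturbation \<delta>)
        show "0 \<le> inner y y + 2 * \<delta> * (- inner y k) + \<delta>\<^sup>2 * inner k k"
          using inner_ge_zero[of "y - \<delta> *\<^sub>R k"]
          by (simp add: inner_diff_left inner_diff_right inner_commute[of k y] power2_eq_square algebra_simps)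
        show "0 \<le> inner y y - 2 * \<delta> * (- inner y k) + \<delta>\<^sup>2 * inner k k"
          using inner_ge_zero[of "y + \<delta> *\<^sub>R k"]
          by (simp add: inner_add_left inner_add_right inner_commute[of k y] power2_eq_square algebra_simps)
      qed simp
      have "\<Phi> (z n) x = y + k" using elim(3) by (simp add: y_def k_def)
      then have "(norm (\<Phi> (z n) x))\<^sup>2 - ?q x = inner y y - 2 * (- inner y k)"
        by (simp add: power2_norm_eq_inner inner_add_left inner_add_right inner_commute[of k y] k_def[symmetric])
      then have "\<Gamma> f f x - ?q x = (inner y y - 2 * (- inner y k)) - (\<Gamma> (a n) (a n) x - 2 * \<Gamma> (a n) f x)"
        using elim(1,2) by linarith
      then have "\<bar>\<Gamma> f f x - ?q x\<bar> \<le> \<bar>inner y y - 2 * (- inner y k)\<bar> + \<bar>\<Gamma> (a n) (a n) x - 2 * \<Gamma> (a n) f x\<bar>"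
        by linarith
      also have "\<dots> \<le> ((1 + 1 / \<delta>) * inner y y + \<delta> * inner k k) + ((1 + 1 / \<delta>) * \<Gamma> (a n) (a n) x + \<delta> * \<Gamma> f f x)"
        using 1 2 by (rule add_mono[rotated])
      also have "\<dots> = (1 + 1 / \<delta>) * (\<Gamma> (a n) (a n) x + ?r x) + \<delta> * (\<Gamma> f f x + ?q x)"
        by (simp add: y_def[symmetric] k_def[symmetric] power2_norm_eq_inner distrib_left)
      finally show ?case .
    qed
    then have "I \<le> (\<integral>x. (1 + 1 / \<delta>) * (\<Gamma> (a n) (a n) x + ?r x) + \<delta> * (\<Gamma> f f x + ?q x) \<partial>M)"
      unfolding I_def using G_int q_int a_int r_int by (intro integral_mono_AE) auto
    also have "\<dots> = (1 + 1 / \<delta>) * (E (a n) (a n) + (norm (z n - \<zeta>))\<^sup>2) + \<delta> * (E f f + (norm \<zeta>)\<^sup>2)"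
      using G_int q_int a_int r_int
      by (simp add: Gamma_integral[OF f f] Gamma_integral[OF aD aD] norm_square_eq)
    finally show ?thesis .
  qed
  define K where "K = E f f + (norm \<zeta>)\<^sup>2"
  have I_le_K: "I \<le> \<delta> * K" if \<delta>: "0 < \<delta>" for \<delta>
  proof (rule tendsto_lowerbound[OF _ always_eventually])
    have "(\<lambda>n. norm (z n - \<zeta>)) \<longlonglongrightarrow> 0" using z_lim LIM_zero tendsto_norm_zero by blast
    moreover have "(\<lambda>n. sqrt (E (a n) (a n))) \<longlonglongrightarrow> 0"
      by (rule Lim_null_comparison[OF always_eventually to0]) (use a_le(1) form_nonneg[OF aD] in simp)
    ultimately have "(\<lambda>n. (1 + 1 / \<delta>) * ((sqrt (E (a n) (a n)))\<^sup>2 + (norm (z n - \<zeta>))\<^sup>2) + \<delta> * K)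
        \<longlonglongrightarrow> (1 + 1 / \<delta>) * (0\<^sup>2 + 0\<^sup>2) + \<delta> * K"
      by (intro tendsto_intros)
    then show "(\<lambda>n. (1 + 1 / \<delta>) * (E (a n) (a n) + (norm (z n - \<zeta>))\<^sup>2) + \<delta> * K) \<longlonglongrightarrow> \<delta> * K"
      using form_nonneg[OF aD] by simp
    show "\<forall>n. I \<le> (1 + 1 / \<delta>) * (E (a n) (a n) + (norm (z n - \<zeta>))\<^sup>2) + \<delta> * K"
      using I_le[OF \<delta>] by (simp add: K_def)
  qed simp
  have "I \<le> 0"
  proof (rule tendsto_lowerbound)
    show "((\<lambda>\<delta>. \<delta> * K) \<longlongrightarrow> 0) (at_right 0)" by (auto intro!: tendsto_eq_intros)
    show "\<forall>\<^sub>F \<delta> in at_right 0. I \<le> \<delta> * K"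
      using eventually_at_right_less[of 0] by eventually_elim (rule I_le_K)
  qed simp
  then have "I = 0" unfolding I_def by (intro antisym) auto
  then have "AE x in M. \<bar>\<Gamma> f f x - ?q x\<bar> = 0"
    using integral_nonneg_eq_0_iff_AE[of M "\<lambda>x. \<bar>\<Gamma> f f x - ?q x\<bar>"] G_int q_int by (simp add: I_def)
  then have "AE x in M. norm (\<Phi> \<zeta> x) = sqrt (\<Gamma> f f x)"
    by eventually_elim simp
  then show ?thesis using grad by blast
qed

end

section \<open>Comparison of the variation with the energy\<close>

context form_calculus
begin

lemma Var_le_integral_fibre_norm:
  assumes grad: "(f, \<zeta>) \<in> grad M D tens"
  shows "Var M D tens \<Phi> f \<le> ereal (\<integral>x. norm (\<Phi> \<zeta> x) \<partial>M)"
  unfolding Var_def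
proof (rule Sup_least, clarify)
  fix \<eta> w assume adj: "(\<eta>, w) \<in> grad_adj M D tens" and le: "AE x in M. norm (\<Phi> \<eta> x) \<le> 1"
  have "L2_inner M f w = (\<integral>x. inner (\<Phi> \<zeta> x) (\<Phi> \<eta> x) \<partial>M)"
    using adj grad Phi_isometric by (fastforce simp: grad_adj_def)
  also have "\<dots> \<le> (\<integral>x. norm (\<Phi> \<zeta> x) \<partial>M)"
  proof (intro integral_mono_AE fibre_inner_integrable fibre_norm_integrable)
    show "AE x in M. inner (\<Phi> \<zeta> x) (\<Phi> \<eta> x) \<le> norm (\<Phi> \<zeta> x)"
      using le
    proof eventually_elim
      case (elim x)
      show ?case
        using norm_cauchy_schwarz[of "\<Phi> \<zeta> x" "\<Phi> \<eta> x"] mult_left_mono[OF elim norm_ge_zero[of "\<Phi> \<zeta> x"]]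
        by simp
    qed
  qed
  finally show "ereal (L2_inner M f w) \<le> ereal (\<integral>x. norm (\<Phi> \<zeta> x) \<partial>M)" by simp
qed

lemma Var_ge_scaled:
  assumes grad: "(f, \<zeta>) \<in> grad M D tens" and adj: "(\<eta>, w) \<in> grad_adj M D tens"
    and le: "AE x in M. norm (\<Phi> \<eta> x) \<le> K" and "0 < K"
  shows "ereal (inner \<zeta> \<eta> / K) \<le> Var M D tens \<Phi> f"
proof -
  let ?c = "1 / K"
  have w: "w \<in> L2 M" and eq: "\<And>g \<xi>. (g, \<xi>) \<in> grad M D tens \<Longrightarrow> inner \<xi> \<eta> = L2_inner M g w"
    using adj by (auto simp: grad_adj_def)
  have scale: "L2_inner M g (\<lambda>x. ?c * w x) = ?c * L2_inner M g w" for g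
    by (simp add: L2_inner_def)
  have "(?c *\<^sub>R \<eta>, \<lambda>x. ?c * w x) \<in> grad_adj M D tens"
    unfolding grad_adj_def using L2_scale[OF w, of ?c] eq scale by auto
  moreover have "AE x in M. norm (\<Phi> (?c *\<^sub>R \<eta>) x) \<le> 1"
    using le Phi_linear[of ?c \<eta> 0 \<eta>] by eventually_elim (use \<open>0 < K\<close> in \<open>simp add: field_simps\<close>)
  ultimately have "ereal (L2_inner M f (\<lambda>x. ?c * w x)) \<le> Var M D tens \<Phi> f"
    unfolding Var_def by (intro Sup_upper) blast
  then show ?thesis using eq[OF grad] scale by simp
qed

text \<open>The test form is the time average over \<open>{0..s}\<close> of the orbit of \<open>\<eta>\<^sub>0\<close>, the direction of the
  gradient. The average lies in the domain of the adjoint and its fibre norm is at most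
  \<open>C1\<close>; pairing with the gradient recovers the integral of the fibre norm as \<open>s\<close> tends to zero.\<close>

lemma integral_fibre_norm_le_Var:
  fixes vP :: "real \<Rightarrow> 'h \<Rightarrow> 'h"
  assumes flow: "heat_flow M D E P p"
    and sg: "semigroup_generated (form_laplacian M D tens) vP"
    and "1 \<le> C1"
    and dom: "\<And>\<eta> t. 0 \<le> t \<Longrightarrow> t \<le> 1 \<Longrightarrow>
      AE x in M. norm (\<Phi> (vP t \<eta>) x) \<le> C1 * P t (\<lambda>y. norm (\<Phi> \<eta> y)) x"
    and grad: "(f, \<zeta>) \<in> grad M D tens"
  shows "ereal ((\<integral>x. norm (\<Phi> \<zeta> x) \<partial>M) / C1) \<le> Var M D tens \<Phi> f"
proof -
  interpret heat_flow M D E P p by fact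
  interpret vP: semigroup_generated "form_laplacian M D tens" vP by fact
  have C1: "0 < C1" using \<open>1 \<le> C1\<close> by simp
  have bounded: "norm (vP t v) \<le> C1 * norm v" if t: "0 \<le> t" "t \<le> 1" for t v
  proof -
    let ?g = "\<lambda>y. norm (\<Phi> v y)"
    have Pg: "P t ?g \<in> L2 M" using P_L2[OF t(1) fibre_norm_L2] .
    have "norm (vP t v) \<le> L2_norm M (\<lambda>x. C1 * P t ?g x)"
      unfolding norm_eq_L2_norm[of "vP t v"]
    proof (intro L2_norm_mono fibre_norm_measurable L2_scale Pg)
      show "AE x in M. \<bar>norm (\<Phi> (vP t v) x)\<bar> \<le> \<bar>C1 * P t ?g x\<bar>"
        using dom[OF t, of v] by eventually_elim (metis abs_norm_cancel abs_ge_self order_trans)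
    qed
    also have "\<dots> \<le> C1 * L2_norm M (P t ?g)"
      using L2_triangle[OF Pg Pg, of C1 0] C1 by simp
    also have "\<dots> \<le> C1 * norm v"
      unfolding norm_eq_L2_norm[of v] using C1 P_contraction[OF fibre_norm_L2 t(1)] by simp
    finally show ?thesis .
  qed
  obtain \<eta>\<^sub>0 where \<eta>\<^sub>0: "AE x in M. norm (\<Phi> \<eta>\<^sub>0 x) \<le> 1"
    and pairing: "inner \<zeta> \<eta>\<^sub>0 = (\<integral>x. norm (\<Phi> \<zeta> x) \<partial>M)"
    using fibre_direction_exists by blast
  have orbit_bound: "AE x in M. norm (\<Phi> (vP t \<eta>\<^sub>0) x) \<le> C1" if t: "0 \<le> t" "t \<le> 1" for t
  proof -
    have "AE x in M. 0 \<le> norm (\<Phi> \<eta>\<^sub>0 x) \<and> norm (\<Phi> \<eta>\<^sub>0 x) \<le> 1"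
      using \<eta>\<^sub>0 by eventually_elim simp
    from P_Markov[OF fibre_norm_L2 this t(1)] dom[OF t, of \<eta>\<^sub>0] show ?thesis
    proof eventually_elim
      case (elim x)
      then show ?case using mult_left_mono[OF elim(1), of C1] C1 by linarith
    qed
  qed
  have cont: "continuous_on {0..1} (\<lambda>t. vP t \<eta>\<^sub>0)"
    by (rule semigroup_orbit_continuous[OF sg bounded])
  show ?thesis
  proof (rule ereal_le_epsilon2)
    fix e :: real assume "0 < e"
    then have "inner \<eta>\<^sub>0 \<zeta> - e < inner \<eta>\<^sub>0 \<zeta>" by simp
    moreover have "((\<lambda>t. inner (vP t \<eta>\<^sub>0) \<zeta>) \<longlongrightarrow> inner \<eta>\<^sub>0 \<zeta>) (at_right 0)"
      by (intro tendsto_intros vP.T_cont)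
    ultimately have "\<forall>\<^sub>F t in at_right 0. inner \<eta>\<^sub>0 \<zeta> - e < inner (vP t \<eta>\<^sub>0) \<zeta>"
      using order_tendstoD(1) by blast
    then obtain b where b: "0 < b" "\<And>t. 0 < t \<Longrightarrow> t < b \<Longrightarrow> inner \<eta>\<^sub>0 \<zeta> - e < inner (vP t \<eta>\<^sub>0) \<zeta>"
      by (auto simp: eventually_at_right_field)
    define s where "s = min (b / 2) (1 / 2)"
    have s: "0 < s" "s < b" "s < 1" using b(1) by (auto simp: s_def)
    have orbit_ge: "inner \<eta>\<^sub>0 \<zeta> - e \<le> inner (vP t \<eta>\<^sub>0) \<zeta>" if "t \<in> {0..s}" for t
      using b(2)[of t] that s \<open>0 < e\<close> vP.T_0 by (cases "t = 0") auto
    obtain V where V: "\<And>\<nu>. inner V \<nu> = integral {0..s} (\<lambda>t. inner (vP t \<eta>\<^sub>0) \<nu>)"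
      and "(V, vP s \<eta>\<^sub>0 - \<eta>\<^sub>0) \<in> form_laplacian M D tens"
      using weak_orbit_integral[OF sg bounded s(1,3)] by blast
    then obtain w where adj: "(V, w) \<in> grad_adj M D tens"
      by (auto simp: form_laplacian_def)
    have cont_s: "continuous_on {0..s} (\<lambda>t. vP t \<eta>\<^sub>0)"
      using s by (intro continuous_on_subset[OF cont]) auto
    have "AE x in M. norm (\<Phi> V x) \<le> s * C1"
      using s C1 orbit_bound by (intro weak_integral_fibre_bound[OF V cont_s]) auto
    then have "ereal (inner \<zeta> V / (s * C1)) \<le> Var M D tens \<Phi> f"
      using s C1 by (intro Var_ge_scaled[OF grad adj]) auto
    moreover have "(inner \<zeta> \<eta>\<^sub>0 - e) * s \<le> inner \<zeta> V"
    proof -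
      have "integral {0..s} (\<lambda>_. inner \<eta>\<^sub>0 \<zeta> - e) \<le> integral {0..s} (\<lambda>t. inner (vP t \<eta>\<^sub>0) \<zeta>)"
        using orbit_ge cont_s by (intro integral_le integrable_continuous_real continuous_intros) auto
      then show ?thesis
        using s unfolding V[symmetric] by (simp add: inner_commute[of \<zeta>] mult.commute)
    qed
    then have "((inner \<zeta> \<eta>\<^sub>0 - e) * s) / (s * C1) \<le> inner \<zeta> V / (s * C1)"
      using s C1 by (intro divide_right_mono) auto
    then have "(inner \<zeta> \<eta>\<^sub>0 - e) / C1 \<le> inner \<zeta> V / (s * C1)"
      using s by simp
    moreover have "inner \<zeta> \<eta>\<^sub>0 / C1 - e \<le> (inner \<zeta> \<eta>\<^sub>0 - e) / C1"
      using \<open>1 \<le> C1\<close> \<open>0 < e\<close> by (simp add: diff_divide_distrib divide_le_eq)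
    ultimately have "ereal (inner \<zeta> \<eta>\<^sub>0 / C1 - e) \<le> Var M D tens \<Phi> f"
      by (meson ereal_less_eq(3) order_trans)
    then show "ereal ((\<integral>x. norm (\<Phi> \<zeta> x) \<partial>M) / C1) \<le> Var M D tens \<Phi> f + ereal e"
      unfolding pairing[symmetric] by (cases "Var M D tens \<Phi> f") auto
  qed
qed

end

theorem lemma3p1:
  fixes M :: "'a::metric_space measure"
    and D :: "('a \<Rightarrow> real) set"
    and E :: "('a \<Rightarrow> real) \<Rightarrow> ('a \<Rightarrow> real) \<Rightarrow> real"
    and \<Gamma> :: "('a \<Rightarrow> real) \<Rightarrow> ('a \<Rightarrow> real) \<Rightarrow> 'a \<Rightarrow> real"
    and tens :: "('a \<Rightarrow> real) \<Rightarrow> ('a \<Rightarrow> real) \<Rightarrow> 'h::{real_inner, complete_space}"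
    and F :: "'a \<Rightarrow> 'k::{real_inner, complete_space} set"
    and S :: "('a \<Rightarrow> 'k) set"
    and \<Phi> :: "'h \<Rightarrow> 'a \<Rightarrow> 'k"
    and P :: "real \<Rightarrow> ('a \<Rightarrow> real) \<Rightarrow> ('a \<Rightarrow> real)"
    and vP :: "real \<Rightarrow> 'h \<Rightarrow> 'h"
    and p :: "real \<Rightarrow> 'a \<Rightarrow> 'a \<Rightarrow> real"
    and C1 :: real
    and f :: "'a \<Rightarrow> real"
  assumes "compact_metric_prob M"
    and "dirichlet_form M D E" and "regular_form M D E" and "strictly_local M D E"
    and "carre_du_champ M D E \<Gamma>"
    and "L2_semigroup_generated M (laplacian M D E) P"
    and "one_forms M D \<Gamma> tens"
    and "semigroup_generated (form_laplacian M D tens) vP"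
    and "direct_integral_decomposition M F S D \<Gamma> tens \<Phi>"
    and "1 \<le> C1"
    and "\<And>\<eta> t. 0 \<le> t \<Longrightarrow> t \<le> 1 \<Longrightarrow>
           AE x in M. norm (\<Phi> (vP t \<eta>) x) \<le> C1 * P t (\<lambda>y. norm (\<Phi> \<eta> y)) x"
    and "heat_kernel M P p"
    and "f \<in> D"
  shows "ereal (1 / C1 * (\<integral>x. sqrt (\<Gamma> f f x) \<partial>M)) \<le> Var M D tens \<Phi> f \<and>
         Var M D tens \<Phi> f \<le> ereal (\<integral>x. sqrt (\<Gamma> f f x) \<partial>M)"
proof -
  interpret compact_metric_prob M by fact
  interpret dirichlet_form M D E by fact
  interpret carre_du_champ M D E \<Gamma> by fact
  interpret L2_semigroup_generated M "laplacian M D E" P by fact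
  interpret one_forms M D \<Gamma> tens by fact
  interpret direct_integral_decomposition M F S D \<Gamma> tens \<Phi> by fact
  interpret heat_kernel M P p by fact
  interpret form_calculus M D E \<Gamma> tens F S \<Phi> ..
  have flow: "heat_flow M D E P p" ..
  obtain \<zeta> where grad: "(f, \<zeta>) \<in> grad M D tens" and norm: "AE x in M. norm (\<Phi> \<zeta> x) = sqrt (\<Gamma> f f x)"
    using gradient_exists[OF \<open>regular_form M D E\<close> \<open>f \<in> D\<close>] by blast
  have [measurable]: "\<Gamma> f f \<in> borel_measurable M"
    using Gamma_L1[OF \<open>f \<in> D\<close> \<open>f \<in> D\<close>] by (rule borel_measurable_integrable)
  have eq: "(\<integral>x. norm (\<Phi> \<zeta> x) \<partial>M) = (\<integral>x. sqrt (\<Gamma> f f x) \<partial>M)"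
    using norm by (intro integral_cong_AE) auto
  show ?thesis
    using Var_le_integral_fibre_norm[OF grad]
      integral_fibre_norm_le_Var[OF flow assms(8) \<open>1 \<le> C1\<close> assms(11) grad]
    unfolding eq by simp
qed

end
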